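(* Let $R=\bigoplus_{n\geq0}R_n$ be a graded $\mathbb Q$-algebra of finite type which is an integral domain with $\dim_{\mathbb Q}R_n<\infty$ for all $n$, and let $\mathscr R=\bigoplus_n\mathscr R_n$ be a graded subalgebra with each $\mathscr R_n$ a finitely generated $\mathbb Z$-module and $\mathscr R_n\otimes_{\mathbb Z}\mathbb Q=R_n$. For each $n$ let $\|\cdot\|_n$ be a norm on $R_n\otimes_{\mathbb Q}\mathbb R$ such that $\|ab\|_{n+n'}\leq\|a\|_n\|b\|_{n'}$ for $a\in\mathscr R_n$, $b\in\mathscr R_{n'}$. Let $X=\operatorname{Proj}(R)$, $d=\dim X$, and $\mathfrak S_X$ the set of closed subvarieties of $X$. For $Y\in\mathfrak S_X$ with homogeneous prime ideal $P=\bigoplus P_n$, set $R_{Y,n}=R_n/P_n$, $\mathscr R_{Y,n}=\mathscr R_n/(P_n\cap\mathscr R_n)$, and let $\|\cdot\|^{\mathrm{quot}}_{Y,n}$ be the quotient norm on $R_{Y,n}\otimes\mathbb R$ induced by $\|\cdot\|_n$. Let $\upsilon:\mathfrak S_X\to\mathbb R_{>0}$ be a map such that for every $Y\in\mathfrak S_X$ there are $n(Y)\geq1$ and $s_Y\in\mathscr R_{Y,n(Y)}\setminus\{0\}$ with $\|s_Y\|^{\mathrm{quot}}_{Y,n(Y)}\leq\upsilon(Y)^{n(Y)}$. Then there are $B>0$ and a finite subset $S\subseteq\mathfrak S_X$ such that for all $n\geq1$, $\lambda_{\mathbb Q}(\mathscr R_n,\|\cdot\|_n)\leq B\,n^{d(d+1)/2}\big(\max_{Y\in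 S}\upsilon(Y)\big)^n.$
   Context: A closed subvariety means a closed, reduced and irreducible subscheme over $\mathbb Q$. For a finitely generated $\mathbb Z$-module $\mathscr M$ with a norm $\|\cdot\|$ on $\mathscr M\otimes_{\mathbb Z}\mathbb R$: if $\mathscr M$ is torsion, $\lambda_{\mathbb Q}(\mathscr M,\|\cdot\|)=0$; otherwise $\lambda_{\mathbb Q}(\mathscr M,\|\cdot\|)$ is the infimum of $\lambda\geq0$ such that there is a $\mathbb Q$-basis $e_1,\ldots,e_r$ of $\mathscr M\otimes\mathbb Q$ contained in $\mathscr M$ with $\|e_i\|\leq\lambda$ for all $i$. *)

theory Defs
  imports "HOL-Analysis.Analysis"
begin

text \<open>The graded Q-algebra R is an integral domain containing Q, hence embeds in its
fraction field, a field of characteristic 0.  We model R inside an arbitrary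
field 'a of characteristic 0; the rationals act through of_rat.
The graded pieces are given by Rg :: nat => 'a set.\<close>

definition qspan :: "'a::field_char_0 set \<Rightarrow> 'a set" where
  "qspan A = {x. \<exists>F c. finite F \<and> F \<subseteq> A \<and> x = (\<Sum>v\<in>F. of_rat (c v) * v)}"

definition qindep :: "'a::field_char_0 set \<Rightarrow> bool" where
  "qindep A \<longleftrightarrow> (\<forall>F c. finite F \<and> F \<subseteq> A \<and> (\<Sum>v\<in>F. of_rat (c v) * v) = 0
      \<longrightarrow> (\<forall>v\<in>F. c v = 0))"

definition zspan :: "'a::field_char_0 set \<Rightarrow> 'a set" where
  "zspan A = {x. \<exists>F c. finite F \<and> F \<subseteq> A \<and> x = (\<Sum>v\<in>F. of_int (c v) * v)}"

inductive_set qalg_gen :: "'a::field_char_0 set \<Rightarrow> 'a set" for G where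
  gen: "x \<in> G \<Longrightarrow> x \<in> qalg_gen G"
| rat: "of_rat q \<in> qalg_gen G"
| add: "x \<in> qalg_gen G \<Longrightarrow> y \<in> qalg_gen G \<Longrightarrow> x + y \<in> qalg_gen G"
| mult: "x \<in> qalg_gen G \<Longrightarrow> y \<in> qalg_gen G \<Longrightarrow> x * y \<in> qalg_gen G"

definition Rtot :: "(nat \<Rightarrow> 'a::field_char_0 set) \<Rightarrow> 'a set" where
  "Rtot Rg = {y. \<exists>F x. finite F \<and> (\<forall>i\<in>F. x i \<in> Rg i) \<and> y = (\<Sum>i\<in>F. x i)}"

definition graded_Qalg_fin_type :: "(nat \<Rightarrow> 'a::field_char_0 set) \<Rightarrow> bool" where
  "graded_Qalg_fin_type Rg \<longleftrightarrow>
     (\<forall>n. qspan (Rg n) = Rg n) \<and>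
     (\<forall>m n. \<forall>x\<in>Rg m. \<forall>y\<in>Rg n. x * y \<in> Rg (m + n)) \<and>
     1 \<in> Rg 0 \<and>
     (\<forall>F x. finite F \<and> (\<forall>i\<in>F. x i \<in> Rg i) \<and> (\<Sum>i\<in>F. x i) = 0 \<longrightarrow> (\<forall>i\<in>F. x i = 0)) \<and>
     (\<exists>G. finite G \<and> G \<subseteq> Rtot Rg \<and> qalg_gen G = Rtot Rg) \<and>
     (\<forall>n. \<exists>F. finite F \<and> qspan F = Rg n)"

text \<open>A graded subalgebra with finitely generated Z-module pieces Zg n
  such that Zg n tensor Q = R_n (i.e. Zg n spans R_n over Q).\<close>
definition integral_structure :: "(nat \<Rightarrow> 'a::field_char_0 set) \<Rightarrow> (nat \<Rightarrow> 'a set) \<Rightarrow> bool" where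
  "integral_structure Rg Zg \<longleftrightarrow>
     (\<forall>n. Zg n \<subseteq> Rg n \<and> zspan (Zg n) = Zg n \<and>
          (\<exists>G. finite G \<and> G \<subseteq> Zg n \<and> zspan G = Zg n) \<and> qspan (Zg n) = Rg n) \<and>
     (\<forall>m n. \<forall>x\<in>Zg m. \<forall>y\<in>Zg n. x * y \<in> Zg (m + n)) \<and>
     1 \<in> Zg 0"

text \<open>V is (a model of) A tensor_Q R, with structure map iota: the map is Q-linear,
  its image spans V over R, and it sends Q-linearly independent sets injectively
  to R-linearly independent sets.  This characterises the base change up to iso.\<close>
definition real_base_change :: "'a::field_char_0 set \<Rightarrow> 'v::real_vector set \<Rightarrow> ('a \<Rightarrow> 'v) \<Rightarrow> bool" where
  "real_base_change A V iota \<longleftrightarrow>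
     (\<forall>x\<in>A. \<forall>y\<in>A. iota (x + y) = iota x + iota y) \<and>
     (\<forall>q. \<forall>x\<in>A. iota (of_rat q * x) = real_of_rat q *\<^sub>R iota x) \<and>
     iota ` A \<subseteq> V \<and> V = span (iota ` A) \<and>
     (\<forall>E \<subseteq> A. qindep E \<longrightarrow> inj_on iota E \<and> independent (iota ` E))"

definition is_norm_on :: "'v::real_vector set \<Rightarrow> ('v \<Rightarrow> real) \<Rightarrow> bool" where
  "is_norm_on V N \<longleftrightarrow>
     (\<forall>x\<in>V. N x \<ge> 0 \<and> (N x = 0 \<longleftrightarrow> x = 0)) \<and>
     (\<forall>c. \<forall>x\<in>V. N (c *\<^sub>R x) = \<bar>c\<bar> * N x) \<and>
     (\<forall>x\<in>V. \<forall>y\<in>V. N (x + y) \<le> N x + N y)"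

text \<open>Closed subvarieties of Proj R = relevant homogeneous prime ideals of R.\<close>
definition relevant_hom_prime :: "(nat \<Rightarrow> 'a::field_char_0 set) \<Rightarrow> 'a set \<Rightarrow> bool" where
  "relevant_hom_prime Rg P \<longleftrightarrow>
     P \<subseteq> Rtot Rg \<and> 0 \<in> P \<and>
     (\<forall>x\<in>P. \<forall>y\<in>P. x + y \<in> P) \<and>
     (\<forall>r\<in>Rtot Rg. \<forall>x\<in>P. r * x \<in> P) \<and>
     1 \<notin> P \<and>
     (\<forall>x\<in>Rtot Rg. \<forall>y\<in>Rtot Rg. x * y \<in> P \<longrightarrow> x \<in> P \<or> y \<in> P) \<and>
     (\<forall>F x. finite F \<and> (\<forall>i\<in>F. x i \<in> Rg i) \<and> (\<Sum>i\<in>F. x i) \<in> P \<longrightarrow> (\<forall>i\<in>F. x i \<in> P)) \<and>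
     \<not> (\<forall>n\<ge>1. Rg n \<subseteq> P)"

definition subvarieties :: "(nat \<Rightarrow> 'a::field_char_0 set) \<Rightarrow> 'a set set" where
  "subvarieties Rg = {P. relevant_hom_prime Rg P}"

text \<open>dim X = supremum of lengths k of chains Y_0 < Y_1 < ... < Y_k of closed
  subvarieties (equivalently P_0 > P_1 > ... > P_k of primes).\<close>
definition dimProj :: "(nat \<Rightarrow> 'a::field_char_0 set) \<Rightarrow> nat" where
  "dimProj Rg = Sup {k. \<exists>c::nat \<Rightarrow> 'a set. (\<forall>i\<le>k. c i \<in> subvarieties Rg) \<and>
                          (\<forall>i<k. c (Suc i) \<subset> c i)}"

text \<open>Quotient norm on (R_n/P_n) tensor R of the class of x in R_n:
  inf of N(iota x + w) over w in P_n tensor R = real span of iota(P_n).\<close>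
definition quot_norm :: "'a::field_char_0 set \<Rightarrow> 'a set \<Rightarrow> ('a \<Rightarrow> 'v::real_vector) \<Rightarrow> ('v \<Rightarrow> real) \<Rightarrow> 'a \<Rightarrow> real" where
  "quot_norm A P iota N x = Inf {N (iota x + w) | w. w \<in> span (iota ` (P \<inter> A))}"

definition lambdaQ :: "'a::field_char_0 set \<Rightarrow> ('a \<Rightarrow> real) \<Rightarrow> real" where
  "lambdaQ M f = (if (\<forall>x\<in>M. \<exists>k::int. k \<noteq> 0 \<and> of_int k * x = 0) then 0
     else Inf {l. l \<ge> 0 \<and> (\<exists>E. E \<subseteq> M \<and> qindep E \<and> qspan E = qspan M \<and> (\<forall>e\<in>E. f e \<le> l))})"

end

theory Submission
  imports Defs "HOL-Computational_Algebra.Polynomial"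
begin

text \<open>For a graded ideal \<open>J\<close> consider the covering radius of the lattice \<open>Zg n\<close> modulo \<open>J n\<close>. Unlike
  successive minima it is subadditive in exact sequences, without any rank factors. The sequence
  \<open>0 \<rightarrow> R/(J : a) \<rightarrow> R/J \<rightarrow> R/(J + (a)) \<rightarrow> 0\<close> reduces, by Noetherian induction, to prime ideals \<open>P\<close>.
  For these take the small section \<open>s\<close> on the subvariety of \<open>P\<close>: filtering \<open>R/P\<close> by powers of \<open>s\<close>
  bounds its radius in degree \<open>n\<close> by a sum of radii of \<open>R/(P + (s))\<close> in degrees up to \<open>n\<close>, weighted by
  powers of \<open>upsilon\<close>; as the dimension drops, this costs one factor \<open>n\<close> per dimension. Finally the
  last successive minimum is at most twice the covering radius. The resulting exponent \<open>d\<close> is at most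
  \<open>d (d + 1) / 2\<close>.\<close>

section \<open>Linear algebra over the rationals\<close>

text \<open>Rank factors arise for successive minima because lifting a short basis of a quotient
  means rounding against a basis of the kernel, with an error summed over that whole basis; a
  covering radius needs only one nearby lattice vector in the quotient and then one in the kernel.
  The main obstacle is the quotient norm: its infimum runs over real vectors and need not be
  attained by a ring element, while submultiplicativity concerns ring elements only. The small
  section is therefore represented by a ring element whose norm is at most the wanted bound times a
  factor \<open>K > 1\<close>. In degree \<open>n\<close> it is used at most \<open>n\<close> times,
  so with \<open>K\<close> the root of order \<open>n + 1\<close> of 2 the total loss is a factor 2.
  The finite set of subvarieties is not written down: the Noetherian induction branches finitely,
  and each relevant prime met on the way contributes its value of \<open>upsilon\<close> to a
  maximum. Since \<open>dimProj\<close> is a supremum of natural numbers, it is informative only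
  once the lengths of chains of primes are known to be bounded; the number of generators of
  \<open>R\<close> is such a bound.\<close>

interpretation Qvec: vector_space "\<lambda>(q::rat) (x::'a::field_char_0). of_rat q * x"
  by unfold_locales (auto simp: algebra_simps of_rat_add of_rat_mult)

interpretation Zmod: Modules.module "\<lambda>(k::int) (x::'a::field_char_0). of_int k * x"
  by unfold_locales (auto simp: algebra_simps)

lemma qspan_eq_span: "qspan A = Qvec.span A"
  unfolding qspan_def Qvec.span_explicit by auto

lemma qindep_iff_independent: "qindep A \<longleftrightarrow> Qvec.independent A"
  unfolding qindep_def Qvec.independent_explicit_module by blast

lemma zspan_eq_span: "zspan A = Zmod.span A"
  unfolding zspan_def Zmod.span_explicit by auto

lemma subspace_if_qspan_eq:
  assumes "qspan A = A"
  shows "Qvec.subspace A"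
  using assms unfolding qspan_eq_span by (metis Qvec.subspace_span)

section \<open>Noetherian rings of finite type\<close>

definition is_subring :: "'a::comm_ring_1 set \<Rightarrow> bool" where
  "is_subring A \<longleftrightarrow> 0 \<in> A \<and> 1 \<in> A \<and> (\<forall>x\<in>A. - x \<in> A) \<and>
     (\<forall>x\<in>A. \<forall>y\<in>A. x + y \<in> A \<and> x * y \<in> A)"

definition is_ideal :: "'a::comm_ring_1 set \<Rightarrow> 'a set \<Rightarrow> bool" where
  "is_ideal A I \<longleftrightarrow> I \<subseteq> A \<and> 0 \<in> I \<and> (\<forall>x\<in>I. \<forall>y\<in>I. x + y \<in> I) \<and> (\<forall>r\<in>A. \<forall>x\<in>I. r * x \<in> I)"

definition noetherian :: "'a::comm_ring_1 set \<Rightarrow> bool" where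
  "noetherian A \<longleftrightarrow> (\<forall>I::nat \<Rightarrow> 'a set. (\<forall>k. is_ideal A (I k)) \<and> (\<forall>k. I k \<subseteq> I (Suc k)) \<longrightarrow>
     (\<exists>N. \<forall>k\<ge>N. I k = I N))"

definition coeffs_in :: "'a::comm_ring_1 set \<Rightarrow> 'a poly set" where
  "coeffs_in A = {p. \<forall>i. coeff p i \<in> A}"

definition adjoin :: "'a::comm_ring_1 set \<Rightarrow> 'a \<Rightarrow> 'a set" where
  "adjoin A g = (\<lambda>p. poly p g) ` coeffs_in A"

lemma is_subring_minus: "is_subring A \<Longrightarrow> x \<in> A \<Longrightarrow> y \<in> A \<Longrightarrow> x - y \<in> A"
  unfolding is_subring_def by (metis add_uminus_conv_diff)

lemma is_subring_sum: "is_subring A \<Longrightarrow> (\<And>i. i \<in> F \<Longrightarrow> h i \<in> A) \<Longrightarrow> sum h F \<in> A"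
  by (induction F rule: infinite_finite_induct) (auto simp: is_subring_def)

lemma is_subring_coeffs_in:
  assumes A: "is_subring A"
  shows "is_subring (coeffs_in A)"
proof -
  have "p * q \<in> coeffs_in A" if "p \<in> coeffs_in A" "q \<in> coeffs_in A" for p q
    using that A unfolding coeffs_in_def coeff_mult mem_Collect_eq
    by (auto intro!: is_subring_sum simp: is_subring_def)
  then show ?thesis
    using A by (auto simp: is_subring_def coeffs_in_def coeff_1)
qed

lemma is_subring_adjoin:
  assumes "is_subring A"
  shows "is_subring (adjoin A g)"
proof -
  note C = is_subring_coeffs_in[OF assms, unfolded is_subring_def]
  have "poly p g + poly q g \<in> adjoin A g \<and> poly p g * poly q g \<in> adjoin A g"
    if "p \<in> coeffs_in A" "q \<in> coeffs_in A" for p q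
    using C that unfolding adjoin_def poly_add[symmetric] poly_mult[symmetric] by blast
  moreover have "- poly p g \<in> adjoin A g" if "p \<in> coeffs_in A" for p
    using C that unfolding adjoin_def poly_minus[symmetric] by blast
  moreover have "0 \<in> adjoin A g" "1 \<in> adjoin A g"
    using C unfolding adjoin_def by (metis imageI poly_0, metis imageI poly_1)
  ultimately show ?thesis
    unfolding is_subring_def by (auto simp: adjoin_def)
qed

lemma monom_in_coeffs_in: "is_subring A \<Longrightarrow> c \<in> A \<Longrightarrow> monom c n \<in> coeffs_in A"
  by (auto simp: coeffs_in_def is_subring_def)

lemma adjoin_base: "is_subring A \<Longrightarrow> A \<subseteq> adjoin A g"
  unfolding adjoin_def using monom_in_coeffs_in[of A _ 0]
  by (force simp: poly_monom image_iff)

lemma adjoin_gen: "is_subring A \<Longrightarrow> g \<in> adjoin A g"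
  unfolding adjoin_def using monom_in_coeffs_in[of A 1 1]
  by (force simp: poly_monom image_iff is_subring_def)

text \<open>The ideals of leading coefficients from Hilbert's proof. They are taken over all
  polynomials whose value at \<open>g\<close> lies in \<open>I\<close>, because \<open>g\<close> may
  be algebraic over \<open>A\<close> and elements of \<open>adjoin A g\<close> then have no degree
  of their own. Allowing degrees below \<open>n\<close> makes the set closed under addition.\<close>

definition lead_ideal :: "'a::comm_ring_1 set \<Rightarrow> 'a \<Rightarrow> nat \<Rightarrow> 'a set \<Rightarrow> 'a set" where
  "lead_ideal A g n I = {coeff p n | p. p \<in> coeffs_in A \<and> degree p \<le> n \<and> poly p g \<in> I}"

lemma is_ideal_lead_ideal:
  assumes A: "is_subring A" and I: "is_ideal (adjoin A g) I"
  shows "is_ideal A (lead_ideal A g n I)"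
proof -
  have C: "is_subring (coeffs_in A)"
    by (rule is_subring_coeffs_in[OF A])
  have "0 \<in> lead_ideal A g n I"
    unfolding lead_ideal_def using C I
    by (auto intro!: exI[of _ 0] simp: is_subring_def is_ideal_def)
  moreover have "x + y \<in> lead_ideal A g n I" 
    if x: "x \<in> lead_ideal A g n I" and y: "y \<in> lead_ideal A g n I" for x y
  proof -
    from x obtain p where p: "x = coeff p n" "p \<in> coeffs_in A" "degree p \<le> n" "poly p g \<in> I"
      unfolding lead_ideal_def by auto
    from y obtain q where q: "y = coeff q n" "q \<in> coeffs_in A" "degree q \<le> n" "poly q g \<in> I"
      unfolding lead_ideal_def by auto
    show ?thesis
      unfolding lead_ideal_def using p q C I
      by (auto intro!: exI[of _ "p + q"] degree_add_le simp: is_subring_def is_ideal_def)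
  qed
  moreover have "r * x \<in> lead_ideal A g n I" 
    if r: "r \<in> A" and x: "x \<in> lead_ideal A g n I" for x r
  proof -
    from x obtain p where p: "x = coeff p n" "p \<in> coeffs_in A" "degree p \<le> n" "poly p g \<in> I"
      unfolding lead_ideal_def by auto
    have "smult r p \<in> coeffs_in A"
      using p(2) r A by (auto simp: coeffs_in_def is_subring_def)
    moreover have "degree (smult r p) \<le> n"
      using p(3) degree_smult_le le_trans by blast
    moreover have "r * poly p g \<in> I"
      using I p(4) r adjoin_base[OF A, of g] by (auto simp: is_ideal_def)
    ultimately show ?thesis
      unfolding lead_ideal_def using p(1) by (auto intro!: exI[of _ "smult r p"])
  qed
  moreover have "lead_ideal A g n I \<subseteq> A"
    unfolding lead_ideal_def coeffs_in_def by auto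
  ultimately show ?thesis
    by (simp add: is_ideal_def)
qed

lemma lead_ideal_mono: "I \<subseteq> J \<Longrightarrow> lead_ideal A g n I \<subseteq> lead_ideal A g n J"
  unfolding lead_ideal_def by auto

lemma lead_ideal_Suc:
  assumes A: "is_subring A" and I: "is_ideal (adjoin A g) I"
  shows "lead_ideal A g n I \<subseteq> lead_ideal A g (Suc n) I"
proof
  fix x assume "x \<in> lead_ideal A g n I"
  then obtain p where p: "x = coeff p n" "p \<in> coeffs_in A" "degree p \<le> n" "poly p g \<in> I"
    unfolding lead_ideal_def by auto
  have "pCons 0 p \<in> coeffs_in A"
    using p(2) A by (auto simp: coeffs_in_def coeff_pCons is_subring_def split: nat.splits)
  moreover have "poly (pCons 0 p) g \<in> I"
    using I p(4) adjoin_gen[OF A, of g] by (auto simp: is_ideal_def)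
  moreover have "degree (pCons 0 p) \<le> Suc n"
    using p(3) degree_pCons_le[of 0 p] by linarith
  ultimately show "x \<in> lead_ideal A g (Suc n) I"
    unfolding lead_ideal_def using p(1)
    by (auto intro!: exI[of _ "pCons 0 p"] simp del: poly_pCons)
qed

text \<open>Induction on the degree of a representing polynomial: equality of the leading ideals
  provides a polynomial with value in \<open>I\<close> and the same coefficient in degree
  \<open>n\<close>, and subtracting it lowers the degree.\<close>

lemma eq_if_lead_ideal_eq:
  assumes A: "is_subring A" and I: "is_ideal (adjoin A g) I" and J: "is_ideal (adjoin A g) J"
    and IJ: "I \<subseteq> J" and lead: "\<And>n. lead_ideal A g n I = lead_ideal A g n J"
  shows "I = J"
proof -
  have C: "is_subring (coeffs_in A)"
    by (rule is_subring_coeffs_in[OF A])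
  have main: "p \<in> coeffs_in A \<Longrightarrow> degree p < n \<Longrightarrow> poly p g \<in> J \<Longrightarrow> poly p g \<in> I" for p n
  proof (induction n arbitrary: p)
    case (Suc n)
    have "coeff p n \<in> lead_ideal A g n J"
      unfolding lead_ideal_def using Suc.prems by auto
    then obtain q where q: "coeff p n = coeff q n" "q \<in> coeffs_in A" "degree q \<le> n" "poly q g \<in> I"
      using lead[of n] unfolding lead_ideal_def by auto
    have pq: "p - q \<in> coeffs_in A"
      using is_subring_minus[OF C] Suc.prems q by blast
    have m1: "-1 \<in> adjoin A g"
      using is_subring_adjoin[OF A] by (simp add: is_subring_def)
    have "poly (p - q) g = poly p g + (-1) * poly q g"
      by simp
    then have pqJ: "poly (p - q) g \<in> J"
      using Suc.prems(3) q(4) IJ J m1 unfolding is_ideal_def by (metis subsetD)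
    have "poly (p - q) g \<in> I"
    \<comment> \<open>The zero polynomial has degree 0, so for \<open>n = 0\<close> a vanishing top
      coefficient does not lower the degree.\<close>
    proof (cases "p = q")
      case True
      then show ?thesis using I by (simp add: is_ideal_def)
    next
      case False
      have "degree (p - q) \<le> n"
        using Suc.prems(2) q(3) by (intro degree_diff_le) auto
      moreover have "degree (p - q) \<noteq> n"
        using q(1) False by (metis coeff_diff eq_iff_diff_eq_0 leading_coeff_0_iff)
      ultimately show ?thesis
        using Suc.IH[OF pq _ pqJ] by simp
    qed
    then have "poly (p - q) g + poly q g \<in> I"
      using q(4) I unfolding is_ideal_def by blast
    then show ?case by simp
  qed simp
  have "J \<subseteq> I"
  proof
    fix x assume x: "x \<in> J"
    then obtain p where "p \<in> coeffs_in A" "x = poly p g"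
      using J unfolding is_ideal_def adjoin_def by blast
    then show "x \<in> I"
      using main[of p "Suc (degree p)"] x by simp
  qed
  with IJ show ?thesis by simp
qed

text \<open>Hilbert's basis theorem. The diagonal chain of leading ideals bounds the stable range in
  the degree; the finitely many remaining degrees stabilise individually.\<close>

lemma noetherian_adjoin:
  fixes A :: "'a::comm_ring_1 set"
  assumes A: "is_subring A" and noeth: "noetherian A"
  shows "noetherian (adjoin A g)"
  unfolding noetherian_def
proof (intro allI impI)
  fix I :: "nat \<Rightarrow> 'a set"
  assume "(\<forall>k. is_ideal (adjoin A g) (I k)) \<and> (\<forall>k. I k \<subseteq> I (Suc k))"
  then have I: "\<And>k. is_ideal (adjoin A g) (I k)" and S: "\<And>k. I k \<subseteq> I (Suc k)"
    by auto
  define L where "L n k = lead_ideal A g n (I k)" for n k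
  have mono_I: "I j \<subseteq> I k" if "j \<le> k" for j k
    using lift_Suc_mono_le[of I j k] S that by blast
  have mono: "L n j \<subseteq> L m k" if "n \<le> m" "j \<le> k" for n m j k
  proof -
    have "L n j \<subseteq> L m j"
      using lift_Suc_mono_le[of "\<lambda>n. L n j" n m] lead_ideal_Suc[OF A I] that(1)
      unfolding L_def by blast
    also have "\<dots> \<subseteq> L m k"
      unfolding L_def by (intro lead_ideal_mono mono_I that)
    finally show ?thesis .
  qed
  have ideal: "is_ideal A (L n k)" for n k
    unfolding L_def by (rule is_ideal_lead_ideal[OF A I])
  have "\<exists>N. \<forall>k\<ge>N. L k k = L N N"
    using noeth ideal mono unfolding noetherian_def
    by (elim allE[of _ "\<lambda>k. L k k"]) auto
  then obtain N where N: "\<And>k. k \<ge> N \<Longrightarrow> L k k = L N N" by blast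
  have "\<exists>N. \<forall>k\<ge>N. L n k = L n N" for n
    using noeth ideal mono unfolding noetherian_def
    by (elim allE[of _ "\<lambda>k. L n k"]) auto
  then obtain h where h: "\<And>n k. k \<ge> h n \<Longrightarrow> L n k = L n (h n)" by metis
  define K where "K = Max (insert N (h ` {..<N}))"
  have KN: "N \<le> K" and Kh: "\<And>n. n < N \<Longrightarrow> h n \<le> K"
    unfolding K_def by (auto intro!: Max_ge)
  have "I k = I K" if k: "k \<ge> K" for k
  proof -
    have "L n K = L n k" for n
    proof (cases "n < N")
      case True
      then show ?thesis using h[of n K] h[of n k] Kh[of n] k by simp
    next
      case False
      then have n: "N \<le> n" by simp
      \<comment> \<open>Squeezed between \<open>L N N\<close> and the diagonal entry at
        \<open>max n j\<close>.\<close>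
      have "L n j = L N N" if j: "j \<ge> N" for j
      proof
        show "L n j \<subseteq> L N N"
          using mono[of n "max n j" j "max n j"] N[of "max n j"] n by auto
        show "L N N \<subseteq> L n j"
          using mono n j by blast
      qed
      then show ?thesis using KN k by simp
    qed
    then show ?thesis
      using eq_if_lead_ideal_eq[OF A I[of K] I[of k] mono_I[OF k]] unfolding L_def by simp
  qed
  then show "\<exists>N. \<forall>k\<ge>N. I k = I N" by blast
qed

section \<open>Finitely generated algebras over the rationals\<close>

lemma is_subring_qalg_gen: "is_subring (qalg_gen G)"
  unfolding is_subring_def
proof (intro conjI ballI)
  show "0 \<in> qalg_gen G" "1 \<in> qalg_gen G"
    using qalg_gen.rat[of 0 G] qalg_gen.rat[of 1 G] by simp_all
  show "- x \<in> qalg_gen G" if "x \<in> qalg_gen G" for x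
    using qalg_gen.mult[OF qalg_gen.rat[of "-1" G] that] by simp
qed (auto intro: qalg_gen.intros)

lemma qalg_gen_mono: "G \<subseteq> H \<Longrightarrow> qalg_gen G \<subseteq> qalg_gen H"
proof
  fix x assume GH: "G \<subseteq> H" and "x \<in> qalg_gen G"
  from this(2) show "x \<in> qalg_gen H"
    by induction (use GH in \<open>auto intro: qalg_gen.intros\<close>)
qed

lemma qalg_gen_insert: "qalg_gen (insert g G) = adjoin (qalg_gen G) g"
proof
  have A: "is_subring (qalg_gen G)" by (rule is_subring_qalg_gen)
  show "qalg_gen (insert g G) \<subseteq> adjoin (qalg_gen G) g"
  proof
    fix x assume "x \<in> qalg_gen (insert g G)"
    then show "x \<in> adjoin (qalg_gen G) g"
    proof induction
      case (gen x)
      then show ?case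
        using adjoin_gen[OF A, of g] adjoin_base[OF A, of g] qalg_gen.gen[of x G] by auto
    next
      case (rat q)
      then show ?case using adjoin_base[OF A, of g] qalg_gen.rat[of q G] by auto
    qed (use is_subring_adjoin[OF A, of g] in \<open>auto simp: is_subring_def\<close>)
  qed
  show "adjoin (qalg_gen G) g \<subseteq> qalg_gen (insert g G)"
  proof
    fix x assume "x \<in> adjoin (qalg_gen G) g"
    then obtain p where p: "x = poly p g" "p \<in> coeffs_in (qalg_gen G)"
      unfolding adjoin_def by auto
    have A': "is_subring (qalg_gen (insert g G))" by (rule is_subring_qalg_gen)
    have pow: "g ^ i \<in> qalg_gen (insert g G)" for i
      by (induction i) (use A' in \<open>auto simp: is_subring_def intro: qalg_gen.intros\<close>)
    have "coeff p i * g ^ i \<in> qalg_gen (insert g G)" for i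
      using p(2) qalg_gen_mono[of G "insert g G"] pow[of i]
      by (auto simp: coeffs_in_def intro!: qalg_gen.mult)
    then show "x \<in> qalg_gen (insert g G)"
      unfolding p(1) poly_altdef by (intro is_subring_sum[OF A'])
  qed
qed

lemma noetherian_range_of_rat: "noetherian (range of_rat :: 'a::field_char_0 set)"
proof -
  have dich: "I = {0} \<or> I = range of_rat" if I: "is_ideal (range of_rat :: 'a set) I" for I
  proof (cases "I \<subseteq> {0}")
    case True
    then show ?thesis using I by (auto simp: is_ideal_def)
  next
    case False
    then obtain x where x: "x \<in> I" "x \<noteq> 0" by blast
    moreover from x(1) obtain q where "x = of_rat q"
      using I unfolding is_ideal_def by blast
    ultimately have q: "of_rat q \<in> I" "q \<noteq> 0" by auto
    have "of_rat r \<in> I" for r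
    proof -
      have "of_rat (r / q) * of_rat q \<in> I"
        using I q(1) unfolding is_ideal_def by blast
      then show ?thesis using q(2) by (simp add: of_rat_mult[symmetric])
    qed
    then show ?thesis using I by (auto simp: is_ideal_def)
  qed
  show ?thesis
    unfolding noetherian_def
  proof (intro allI impI)
    fix I :: "nat \<Rightarrow> 'a set"
    assume "(\<forall>k. is_ideal (range of_rat) (I k)) \<and> (\<forall>k. I k \<subseteq> I (Suc k))"
    then have I: "\<And>k. is_ideal (range of_rat) (I k)" and S: "\<And>k. I k \<subseteq> I (Suc k)"
      by auto
    have mono: "I j \<subseteq> I k" if "j \<le> k" for j k
      using lift_Suc_mono_le[of I j k] S that by blast
    show "\<exists>N. \<forall>k\<ge>N. I k = I N"
    proof (cases "\<exists>N. I N = range of_rat")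
      case True
      then obtain N where "I N = range of_rat" by blast
      then have "I k = I N" if "k \<ge> N" for k
        using mono[OF that] I[of k] by (auto simp: is_ideal_def)
      then show ?thesis by blast
    next
      case False
      then have "I k = {0}" for k using dich[OF I, of k] by blast
      then show ?thesis by auto
    qed
  qed
qed

lemma noetherian_qalg_gen: "finite G \<Longrightarrow> noetherian (qalg_gen G)"
proof (induction G rule: finite_induct)
  case empty
  have "x \<in> range of_rat" if "x \<in> qalg_gen {}" for x :: 'a
    using that
  proof induction
    case (add x y)
    then show ?case by (metis (no_types, lifting) image_iff of_rat_add range_eqI)
  next
    case (mult x y)
    then show ?case by (metis (no_types, lifting) image_iff of_rat_mult range_eqI)
  qed auto
  then have "qalg_gen {} = (range of_rat :: 'a set)"
    by (auto intro: qalg_gen.rat)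
  then show ?case by (simp add: noetherian_range_of_rat)
next
  case (insert g G)
  then show ?case
    by (simp add: qalg_gen_insert noetherian_adjoin is_subring_qalg_gen)
qed

section \<open>Lengths of chains of primes\<close>

definition is_prime_ideal :: "'a::comm_ring_1 set \<Rightarrow> 'a set \<Rightarrow> bool" where
  "is_prime_ideal A P \<longleftrightarrow> is_ideal A P \<and> 1 \<notin> P \<and> (\<forall>x\<in>A. \<forall>y\<in>A. x * y \<in> P \<longrightarrow> x \<in> P \<or> y \<in> P)"

text \<open>Bounding each exponent instead of the total degree gives a box, which is easy to count
  and is compatible with products; only the order of growth in \<open>M\<close> matters.\<close>

definition monomials :: "'a::field_char_0 set \<Rightarrow> nat \<Rightarrow> 'a set" where
  "monomials G M = {\<Prod>g\<in>G. g ^ e g | e. \<forall>g\<in>G. e g \<le> M}"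

definition mon_span :: "'a::field_char_0 set \<Rightarrow> nat \<Rightarrow> 'a set" where
  "mon_span G M = Qvec.span (monomials G M)"

lemma card_monomials:
  assumes "finite G"
  shows "finite (monomials G M)" "card (monomials G M) \<le> (M + 1) ^ card G"
proof -
  let ?E = "PiE G (\<lambda>_. {..M})"
  have sub: "monomials G M \<subseteq> (\<lambda>e. \<Prod>g\<in>G. g ^ e g) ` ?E"
  proof
    fix x assume "x \<in> monomials G M"
    then obtain e where e: "x = (\<Prod>g\<in>G. g ^ e g)" "\<forall>g\<in>G. e g \<le> M"
      unfolding monomials_def by blast
    have "x = (\<Prod>g\<in>G. g ^ restrict e G g)" "restrict e G \<in> ?E"
      using e by auto
    then show "x \<in> (\<lambda>e. \<Prod>g\<in>G. g ^ e g) ` ?E" by blast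
  qed
  have fin: "finite ?E" using assms by (intro finite_PiE) auto
  then show "finite (monomials G M)" using sub finite_surj by blast
  have "card (monomials G M) \<le> card ?E"
    using sub fin surj_card_le by blast
  also have "\<dots> = (M + 1) ^ card G"
    using assms by (simp add: card_PiE)
  finally show "card (monomials G M) \<le> (M + 1) ^ card G" .
qed

lemma mon_span_mono: "M \<le> N \<Longrightarrow> mon_span G M \<subseteq> mon_span G N"
  unfolding mon_span_def monomials_def by (intro Qvec.span_mono) (auto intro: order_trans)

lemma mon_span_mult:
  assumes "finite G" and x: "x \<in> mon_span G M" and y: "y \<in> mon_span G N"
  shows "x * y \<in> mon_span G (M + N)"
proof -
  have mon: "u * v \<in> mon_span G (M + N)" if u: "u \<in> monomials G M" and v: "v \<in> monomials G N" for u v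
  proof -
    obtain e where e: "u = (\<Prod>g\<in>G. g ^ e g)" "\<forall>g\<in>G. e g \<le> M"
      using u unfolding monomials_def by blast
    obtain d where d: "v = (\<Prod>g\<in>G. g ^ d g)" "\<forall>g\<in>G. d g \<le> N"
      using v unfolding monomials_def by blast
    have "u * v = (\<Prod>g\<in>G. g ^ (e g + d g))"
      using e d by (simp add: prod.distrib power_add)
    then have "u * v \<in> monomials G (M + N)"
      unfolding monomials_def using e d by (auto intro!: exI[of _ "\<lambda>g. e g + d g"] add_mono)
    then show ?thesis unfolding mon_span_def by (rule Qvec.span_base)
  qed
  have S: "Qvec.subspace (mon_span G (M + N))" unfolding mon_span_def by simp
  have *: "u * y \<in> mon_span G (M + N)" if u: "u \<in> monomials G M" for u
    using y[unfolded mon_span_def]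
  proof (induction rule: Qvec.span_induct_alt)
    case base
    then show ?case using Qvec.subspace_0[OF S] by simp
  next
    case (step c z w)
    have "of_rat c * (u * z) + u * w \<in> mon_span G (M + N)"
      using S mon[OF u step(1)] step(2) by (intro Qvec.subspace_add Qvec.subspace_scale) auto
    then show ?case by (simp add: algebra_simps)
  qed
  show ?thesis
    using x[unfolded mon_span_def]
  proof (induction rule: Qvec.span_induct_alt)
    case base
    then show ?case using Qvec.subspace_0[OF S] by simp
  next
    case (step c z w)
    have "of_rat c * (z * y) + w * y \<in> mon_span G (M + N)"
      using S *[OF step(1)] step(2) by (intro Qvec.subspace_add Qvec.subspace_scale) auto
    then show ?case by (simp add: algebra_simps)
  qed
qed

lemma one_in_mon_span: "1 \<in> mon_span G M"
  unfolding mon_span_def monomials_def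
  by (intro Qvec.span_base) (auto intro!: exI[of _ "\<lambda>_. 0"])

lemma power_in_mon_span:
  assumes "finite G" "x \<in> mon_span G M"
  shows "x ^ j \<in> mon_span G (j * M)"
proof (induction j)
  case (Suc j)
  then show ?case using mon_span_mult[OF assms Suc] by simp
qed (simp add: one_in_mon_span)

lemma qalg_gen_mon_span:
  assumes G: "finite G" and "x \<in> qalg_gen G"
  shows "\<exists>M. x \<in> mon_span G M"
  using assms(2)
proof induction
  case (gen x)
  have "(\<Prod>g\<in>G. g ^ (if g = x then 1 else 0)) = (\<Prod>g\<in>G. if g = x then x else 1)"
    by (intro prod.cong) auto
  also have "\<dots> = x" using G gen by simp
  finally have "x \<in> monomials G 1"
    unfolding monomials_def by (force intro!: exI[of _ "\<lambda>g. if g = x then 1 else 0"])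
  then show ?case unfolding mon_span_def using Qvec.span_base by blast
next
  case (rat q)
  have "of_rat q * 1 \<in> mon_span G 0"
    using one_in_mon_span[of G 0] unfolding mon_span_def by (rule Qvec.span_scale)
  then show ?case by auto
next
  case (add x y)
  then obtain M N where "x \<in> mon_span G M" "y \<in> mon_span G N" by blast
  then have "x \<in> mon_span G (max M N)" "y \<in> mon_span G (max M N)"
    using mon_span_mono[of M "max M N" G] mon_span_mono[of N "max M N" G] by auto
  then have "x + y \<in> mon_span G (max M N)" unfolding mon_span_def by (rule Qvec.span_add)
  then show ?case by blast
next
  case (mult x y)
  then show ?case using mon_span_mult[OF G] by blast
qed

text \<open>Linear independence in the quotient by \<open>P\<close>. It is stated for families, so
  that distinctness of products \<open>f ^ j * w\<close> follows from independence instead of having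
  to be known beforehand.\<close>

definition indep_mod :: "'a::field_char_0 set \<Rightarrow> 'i set \<Rightarrow> ('i \<Rightarrow> 'a) \<Rightarrow> bool" where
  "indep_mod P I v \<longleftrightarrow> (\<forall>q. (\<Sum>i\<in>I. of_rat (q i) * v i) \<in> P \<longrightarrow> (\<forall>i\<in>I. q i = 0))"

lemma indep_mod_inj_on:
  assumes ind: "indep_mod P I v" and I: "finite I" and P: "0 \<in> P"
  shows "inj_on v I"
proof (rule inj_onI, rule ccontr)
  fix a b assume ab: "a \<in> I" "b \<in> I" "v a = v b" "a \<noteq> b"
  define q :: "'b \<Rightarrow> rat" where "q i = (if i = a then 1 else 0) - (if i = b then 1 else 0)" for i
  have "(\<Sum>i\<in>I. of_rat (q i) * v i) = (\<Sum>i\<in>I. (if i = a then v a else 0) - (if i = b then v b else 0))"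
    by (intro sum.cong) (auto simp: q_def)
  also have "\<dots> = 0" using ab I by (simp add: sum_subtractf)
  finally have "q a = 0" using ind P ab(1) unfolding indep_mod_def by auto
  then show False using ab by (simp add: q_def)
qed

lemma indep_mod_image:
  assumes ind: "indep_mod P I v" and I: "finite I" and P: "0 \<in> P"
  shows "indep_mod P (v ` I) id"
  using ind unfolding indep_mod_def
  by (simp add: sum.reindex[OF indep_mod_inj_on[OF assms]]) (metis comp_def)

lemma indep_mod_imp_independent:
  assumes ind: "indep_mod P W id" and W: "finite W" and P: "0 \<in> P"
  shows "Qvec.independent W"
  unfolding Qvec.independent_explicit_module
proof (intro allI impI)
  fix T u v assume T: "finite T" "T \<subseteq> W" "(\<Sum>v\<in>T. of_rat (u v) * v) = 0" "v \<in> T"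
  define q where "q w = (if w \<in> T then u w else 0)" for w
  have "(\<Sum>w\<in>W. of_rat (q w) * id w) = (\<Sum>w\<in>T. of_rat (u w) * w)"
    using W T(2) by (intro sum.mono_neutral_cong_right) (auto simp: q_def)
  then have "\<forall>w\<in>W. q w = 0"
    using ind T(3) P unfolding indep_mod_def by simp
  then have "q v = 0" using T by auto
  then show "u v = 0" using T by (simp add: q_def)
qed

text \<open>In a relation modulo \<open>Q\<close>, all terms with a positive power of
  \<open>f\<close> lie in \<open>P\<close>, so the coefficients of the zeroth power vanish by
  independence modulo \<open>P\<close>. What remains is a multiple of \<open>f\<close>, and since
  \<open>Q\<close> is prime and omits \<open>f\<close>, one factor \<open>f\<close> can be
  cancelled; this shortens the relation.\<close>

lemma indep_mod_powers:
  assumes A: "is_subring A" and rat: "range of_rat \<subseteq> A"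
    and P: "is_prime_ideal A P" and Q: "is_prime_ideal A Q" and QP: "Q \<subseteq> P"
    and f: "f \<in> P" "f \<notin> Q" and W: "W \<subseteq> A" and ind: "indep_mod P W id"
  shows "indep_mod Q ({..N::nat} \<times> W) (\<lambda>(j, w). f ^ j * w)"
proof -
  have idP: "is_ideal A P" and idQ: "is_ideal A Q"
    using P Q by (auto simp: is_prime_ideal_def)
  have fA: "f \<in> A" using f idP by (auto simp: is_ideal_def)
  have pow: "f ^ j \<in> A" for j
    by (induction j) (use A fA in \<open>auto simp: is_subring_def\<close>)
  define g where "g q j = (\<Sum>w\<in>W. of_rat (q j w) * w)" for q :: "nat \<Rightarrow> 'a \<Rightarrow> rat" and j
  have gA: "g q j \<in> A" for q j
    unfolding g_def
  proof (rule is_subring_sum[OF A])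
    fix w assume "w \<in> W"
    then show "of_rat (q j w) * w \<in> A" using A W rat unfolding is_subring_def by blast
  qed
  have g0: "g q j \<in> P \<Longrightarrow> \<forall>w\<in>W. q j w = 0" for q j
    using ind unfolding g_def indep_mod_def by simp
  have main: "(\<Sum>j\<le>N. f ^ j * g q j) \<in> Q \<Longrightarrow> \<forall>j\<le>N. \<forall>w\<in>W. q j w = 0" for q
  proof (induction N arbitrary: q)
    case 0
    then show ?case using g0[of q 0] QP by auto
  next
    case (Suc N)
    define h where "h = (\<Sum>j\<le>N. f ^ j * g q (Suc j))"
    have hA: "h \<in> A"
      unfolding h_def
      by (intro is_subring_sum[OF A]) (use A pow gA in \<open>auto simp: is_subring_def\<close>)
    have eq: "(\<Sum>j\<le>Suc N. f ^ j * g q j) = g q 0 + f * h"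
      unfolding h_def sum.atMost_Suc_shift by (simp add: sum_distrib_left mult.assoc)
    have "- h * f \<in> P"
      using idP f(1) hA A unfolding is_ideal_def is_subring_def by blast
    moreover have "g q 0 + f * h \<in> P" using Suc.prems QP eq by auto
    ultimately have "- h * f + (g q 0 + f * h) \<in> P"
      using idP unfolding is_ideal_def by blast
    then have "g q 0 \<in> P" by (simp add: algebra_simps)
    then have q0: "\<forall>w\<in>W. q 0 w = 0" by (rule g0)
    then have "g q 0 = 0" by (simp add: g_def)
    then have "f * h \<in> Q" using Suc.prems eq by simp
    then have "h \<in> Q" using Q hA fA f(2) unfolding is_prime_ideal_def by blast
    then have "\<forall>j\<le>N. \<forall>w\<in>W. q (Suc j) w = 0"
      using Suc.IH[of "\<lambda>j. q (Suc j)"] unfolding h_def g_def by simp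
    then show ?case using q0 by (metis Suc_le_mono not0_implies_Suc)
  qed
  show ?thesis
    unfolding indep_mod_def
  proof (intro allI impI)
    fix q :: "nat \<times> 'a \<Rightarrow> rat"
    assume "(\<Sum>i\<in>{..N} \<times> W. of_rat (q i) * (case i of (j, w) \<Rightarrow> f ^ j * w)) \<in> Q"
    also have "(\<Sum>i\<in>{..N} \<times> W. of_rat (q i) * (case i of (j, w) \<Rightarrow> f ^ j * w))
        = (\<Sum>j\<le>N. \<Sum>w\<in>W. of_rat (q (j, w)) * (f ^ j * w))"
      by (subst sum.cartesian_product) (auto intro!: sum.cong)
    also have "\<dots> = (\<Sum>j\<le>N. f ^ j * g (curry q) j)"
      unfolding g_def sum_distrib_left by (intro sum.cong) (auto simp: mult_ac)
    finally show "\<forall>i\<in>{..N} \<times> W. q i = 0" using main[of "curry q"] by auto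
  qed
qed

text \<open>Picking an element in each step of a chain of length \<open>k\<close> yields \<open>(N + 1) ^ k\<close> independent
  monomials, which live in a space of dimension \<open>O(N ^ card G)\<close>.\<close>

lemma prime_chain_length:
  fixes c :: "nat \<Rightarrow> 'a::field_char_0 set"
  assumes G: "finite G" and prime: "\<And>i. i \<le> k \<Longrightarrow> is_prime_ideal (qalg_gen G) (c i)"
    and chain: "\<And>i. i < k \<Longrightarrow> c (Suc i) \<subset> c i"
  shows "k \<le> card G"
proof -
  have A: "is_subring (qalg_gen G)" by (rule is_subring_qalg_gen)
  have rat: "range of_rat \<subseteq> qalg_gen G" by (auto intro: qalg_gen.rat)
  have zero: "0 \<in> c i" if "i \<le> k" for i
    using prime[OF that] by (auto simp: is_prime_ideal_def is_ideal_def)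
  \<comment> \<open>\<open>D\<close> is independent of \<open>N\<close>: the number of independent
    elements grows like the \<open>l\<close>-th power of \<open>N\<close> while the exponents in
    their monomials stay linear in \<open>N\<close>.\<close>
  have "\<exists>D. \<forall>N. \<exists>W. finite W \<and> W \<subseteq> qalg_gen G \<and> W \<subseteq> mon_span G (D * N) \<and> card W = (N + 1) ^ l
      \<and> indep_mod (c l) W id" if "l \<le> k" for l
    using that
  proof (induction l)
    case 0
    have "q = 0" if q: "of_rat q \<in> c 0" for q
    proof (rule ccontr)
      assume "q \<noteq> 0"
      then have "of_rat (inverse q) * of_rat q = (1::'a)" by (simp add: of_rat_mult[symmetric])
      moreover have "of_rat (inverse q) * of_rat q \<in> c 0"
        using prime[of 0] q rat unfolding is_prime_ideal_def is_ideal_def by blast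
      ultimately show False using prime[of 0] by (simp add: is_prime_ideal_def)
    qed
    then have "indep_mod (c 0) {1} id" by (auto simp: indep_mod_def)
    then show ?case
      using A by (intro exI[of _ "0::nat"] allI exI[of _ "{1}"]) (auto simp: one_in_mon_span is_subring_def id_def)
  next
    case (Suc l)
    then have l: "l \<le> k" by simp
    obtain D where D: "\<And>N. \<exists>W. finite W \<and> W \<subseteq> qalg_gen G \<and> W \<subseteq> mon_span G (D * N)
        \<and> card W = (N + 1) ^ l \<and> indep_mod (c l) W id"
      using Suc.IH[OF l] by blast
    obtain f where f: "f \<in> c l" "f \<notin> c (Suc l)" using chain[of l] Suc.prems by auto
    have sub: "c (Suc l) \<subseteq> c l" using chain[of l] Suc.prems by auto
    have fA: "f \<in> qalg_gen G"
      using f(1) prime[of l] Suc.prems by (auto simp: is_prime_ideal_def is_ideal_def)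
    then obtain M where M: "f \<in> mon_span G M" using qalg_gen_mon_span[OF G] by blast
    have "\<exists>W. finite W \<and> W \<subseteq> qalg_gen G \<and> W \<subseteq> mon_span G ((M + D) * N) \<and> card W = (N + 1) ^ Suc l
        \<and> indep_mod (c (Suc l)) W id" for N :: nat
    proof -
      obtain W where W: "finite W" "W \<subseteq> qalg_gen G" "W \<subseteq> mon_span G (D * N)"
        "card W = (N + 1) ^ l" "indep_mod (c l) W id"
        using D[of N] by (elim exE conjE)
      define v where "v = (\<lambda>(j, w). f ^ j * w)"
      let ?I = "{..N} \<times> W"
      have ind: "indep_mod (c (Suc l)) ?I v"
        unfolding v_def
        by (rule indep_mod_powers[OF A rat prime[OF l] prime[OF Suc.prems] sub f W(2) W(5)])
      have fin: "finite ?I" using W by simp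
      have z: "0 \<in> c (Suc l)" using zero Suc.prems by blast
      have pow: "f ^ j \<in> qalg_gen G" for j
        by (induction j) (use A fA in \<open>auto simp: is_subring_def\<close>)
      have "card (v ` ?I) = (N + 1) ^ Suc l"
        using card_image[OF indep_mod_inj_on[OF ind fin z]] W(4) by (simp add: card_cartesian_product)
      moreover have "indep_mod (c (Suc l)) (v ` ?I) id"
        by (rule indep_mod_image[OF ind fin z])
      moreover have "v ` ?I \<subseteq> qalg_gen G"
        using W(2) pow by (auto simp: v_def intro!: qalg_gen.mult)
      moreover have "v ` ?I \<subseteq> mon_span G ((M + D) * N)"
      proof
        fix x assume "x \<in> v ` ?I"
        then obtain j w where jw: "x = f ^ j * w" "j \<le> N" "w \<in> W" by (auto simp: v_def)
        have "x \<in> mon_span G (j * M + D * N)"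
          unfolding jw(1) using power_in_mon_span[OF G M] W(3) jw(3) by (intro mon_span_mult[OF G]) auto
        moreover have "j * M + D * N \<le> (M + D) * N"
          using jw(2) by (simp add: algebra_simps)
        ultimately show "x \<in> mon_span G ((M + D) * N)" using mon_span_mono by blast
      qed
      ultimately show ?thesis using fin by blast
    qed
    then show ?case by blast
  qed
  then obtain D where D: "\<And>N. \<exists>W. finite W \<and> W \<subseteq> mon_span G (D * N) \<and> card W = (N + 1) ^ k
      \<and> indep_mod (c k) W id" by (metis order_refl)
  have bound: "(N + 1) ^ k \<le> (D * N + 1) ^ card G" for N :: nat
  proof -
    obtain W where W: "finite W" "W \<subseteq> mon_span G (D * N)" "card W = (N + 1) ^ k"
      "indep_mod (c k) W id"
      using D[of N] by (elim exE conjE)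
    have "Qvec.independent W" by (rule indep_mod_imp_independent[OF W(4,1) zero]) simp
    then have "card W \<le> card (monomials G (D * N))"
      using Qvec.independent_span_bound[OF card_monomials(1)[OF G]] W(2) unfolding mon_span_def by blast
    then show ?thesis using card_monomials(2)[OF G, of "D * N"] W(3) by simp
  qed
  show ?thesis
  proof (rule ccontr)
    assume "\<not> k \<le> card G"
    then have k: "Suc (card G) \<le> k" by simp
    \<comment> \<open>After cancelling \<open>(N + 1) ^ card G\<close> the comparison of dimensions
      reads \<open>N + 1 \<le> (D + 1) ^ card G\<close>, which this value refutes.\<close>
    define N where "N = (D + 1) ^ card G"
    have "(N + 1) ^ Suc (card G) \<le> (N + 1) ^ k" using k by (intro power_increasing) auto
    also have "\<dots> \<le> (D * N + 1) ^ card G" by (rule bound)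
    also have "\<dots> \<le> ((D + 1) * (N + 1)) ^ card G" by (intro power_mono) auto
    finally have "(N + 1) * (N + 1) ^ card G \<le> (D + 1) ^ card G * (N + 1) ^ card G"
      by (simp only: power_mult_distrib power_Suc)
    then have "N + 1 \<le> (D + 1) ^ card G" by (simp only: mult_le_cancel2) simp
    then show False by (simp add: N_def)
  qed
qed

section \<open>Graded ideals\<close>

definition prime_chain :: "(nat \<Rightarrow> 'a::field_char_0 set) \<Rightarrow> nat \<Rightarrow> (nat \<Rightarrow> 'a set) \<Rightarrow> bool" where
  "prime_chain Rg k c \<longleftrightarrow> (\<forall>i\<le>k. c i \<in> subvarieties Rg) \<and> (\<forall>i<k. c (Suc i) \<subset> c i)"

locale graded_alg =
  fixes Rg :: "nat \<Rightarrow> 'a::field_char_0 set"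
  assumes R: "graded_Qalg_fin_type Rg"
begin

lemma Rg_span: "qspan (Rg n) = Rg n"
  and Rg_mult: "x \<in> Rg m \<Longrightarrow> y \<in> Rg n \<Longrightarrow> x * y \<in> Rg (m + n)"
  and one_in_Rg: "1 \<in> Rg 0"
  and Rg_direct_all: "\<forall>F x. finite F \<and> (\<forall>i\<in>F. x i \<in> Rg i) \<and> (\<Sum>i\<in>F. x i) = 0 \<longrightarrow> (\<forall>i\<in>F. x i = 0)"
  and Rtot_fin_type_ex: "\<exists>G. finite G \<and> G \<subseteq> Rtot Rg \<and> qalg_gen G = Rtot Rg"
  using R unfolding graded_Qalg_fin_type_def by simp_all

lemma Rg_subspace: "Qvec.subspace (Rg n)"
  by (rule subspace_if_qspan_eq[OF Rg_span])

lemma Rg_direct: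
  assumes "finite F" "\<And>i. i \<in> F \<Longrightarrow> x i \<in> Rg i" "(\<Sum>i\<in>F. x i) = 0" "i \<in> F"
  shows "x i = 0"
  using Rg_direct_all[rule_format, of F x i] assms by simp

lemma Rtot_fin_type: obtains G where "finite G" "qalg_gen G = Rtot Rg"
  using Rtot_fin_type_ex by (elim exE conjE)

lemma zero_in_Rg [simp]: "0 \<in> Rg n"
  by (rule Qvec.subspace_0[OF Rg_subspace])

lemma Rg_add: "x \<in> Rg n \<Longrightarrow> y \<in> Rg n \<Longrightarrow> x + y \<in> Rg n"
  by (rule Qvec.subspace_add[OF Rg_subspace])

lemma Rg_diff: "x \<in> Rg n \<Longrightarrow> y \<in> Rg n \<Longrightarrow> x - y \<in> Rg n"
  by (rule Qvec.subspace_diff[OF Rg_subspace])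

lemma Rg_scale: "x \<in> Rg n \<Longrightarrow> of_rat q * x \<in> Rg n"
  by (rule Qvec.subspace_scale[OF Rg_subspace])

text \<open>A graded ideal is stored as the family of its homogeneous pieces, ordered pointwise;
  \<open>Rtot J\<close> is the ideal itself. Covering radii live in single degrees, so this avoids
  extracting components.\<close>

definition gideal :: "(nat \<Rightarrow> 'a set) \<Rightarrow> bool" where
  "gideal J \<longleftrightarrow> (\<forall>n. J n \<subseteq> Rg n \<and> 0 \<in> J n \<and> (\<forall>x\<in>J n. \<forall>y\<in>J n. x + y \<in> J n)) \<and>
     (\<forall>m n. \<forall>x\<in>Rg m. \<forall>y\<in>J n. x * y \<in> J (m + n))"

lemma gideal_subset: "gideal J \<Longrightarrow> x \<in> J n \<Longrightarrow> x \<in> Rg n"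
  unfolding gideal_def by blast

lemma gideal_zero: "gideal J \<Longrightarrow> 0 \<in> J n"
  unfolding gideal_def by blast

lemma gideal_add: "gideal J \<Longrightarrow> x \<in> J n \<Longrightarrow> y \<in> J n \<Longrightarrow> x + y \<in> J n"
  unfolding gideal_def by blast

lemma gideal_mult: "gideal J \<Longrightarrow> x \<in> Rg m \<Longrightarrow> y \<in> J n \<Longrightarrow> x * y \<in> J (m + n)"
  unfolding gideal_def by blast

lemma gideal_scale:
  assumes J: "gideal J" and x: "x \<in> J n"
  shows "of_rat q * x \<in> J n"
proof -
  have "of_rat q \<in> Rg 0" using Rg_scale[OF one_in_Rg, of q] by simp
  from gideal_mult[OF J this x] show ?thesis by simp
qed

lemma gideal_subspace: "gideal J \<Longrightarrow> Qvec.subspace (J n)"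
  unfolding Qvec.subspace_def using gideal_zero gideal_add gideal_scale by blast

lemma gideal_diff: "gideal J \<Longrightarrow> x \<in> J n \<Longrightarrow> y \<in> J n \<Longrightarrow> x - y \<in> J n"
  by (rule Qvec.subspace_diff[OF gideal_subspace])

lemma gideal_sum: "gideal J \<Longrightarrow> (\<And>i. i \<in> F \<Longrightarrow> x i \<in> J n) \<Longrightarrow> sum x F \<in> J n"
  by (rule Qvec.subspace_sum[OF gideal_subspace])

lemma gideal_Rg: "gideal Rg"
  unfolding gideal_def by (auto intro: Rg_add Rg_mult)

lemma Rtot_elem:
  assumes J: "\<And>i. 0 \<in> J i" and y: "y \<in> Rtot J"
  shows "\<exists>x N. (\<forall>i. x i \<in> J i) \<and> (\<forall>i>N. x i = 0) \<and> y = (\<Sum>i\<le>N. x i)"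
proof -
  obtain F h where F: "finite F" "\<And>i. i \<in> F \<Longrightarrow> h i \<in> J i" "y = (\<Sum>i\<in>F. h i)"
    using y unfolding Rtot_def by auto
  define x where "x i = (if i \<in> F then h i else 0)" for i
  define N where "N = Max (insert 0 F)"
  have N: "i \<le> N" if "i \<in> F" for i using that F(1) by (simp add: N_def)
  have "\<forall>i. x i \<in> J i" using F(2) J by (simp add: x_def)
  moreover have "\<forall>i>N. x i = 0" using N by (metis leD x_def)
  moreover have "y = (\<Sum>i\<le>N. x i)"
    unfolding F(3) using N by (intro sum.mono_neutral_cong_left) (auto simp: x_def)
  ultimately show ?thesis by (intro exI[of _ x] exI[of _ N]) simp
qed

lemma Rtot_sum: "finite F \<Longrightarrow> (\<And>i. i \<in> F \<Longrightarrow> x i \<in> J i) \<Longrightarrow> (\<Sum>i\<in>F. x i) \<in> Rtot J"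
  unfolding Rtot_def by (intro CollectI exI[of _ F] exI[of _ x]) simp

lemma Rtot_base: "x \<in> J n \<Longrightarrow> x \<in> Rtot J"
  using Rtot_sum[of "{n}" "\<lambda>_. x" J] by simp

text \<open>The sum has a second homogeneous decomposition, with pieces in \<open>J\<close>. The
  difference of the two over a common index set is zero, so directness identifies them degree by
  degree.\<close>

lemma graded_components:
  assumes J: "gideal J" and F: "finite F" "\<And>i. i \<in> F \<Longrightarrow> x i \<in> Rg i"
    and sum: "(\<Sum>i\<in>F. x i) \<in> Rtot J" and i: "i \<in> F"
  shows "x i \<in> J i"
proof -
  obtain y N where y': "\<forall>i. y i \<in> J i" "\<forall>i>N. y i = 0" "(\<Sum>i\<in>F. x i) = (\<Sum>i\<le>N. y i)"
    using Rtot_elem[where J = J, OF gideal_zero[OF J] sum] by (elim exE conjE)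
  note y = y'(1,2)[rule_format] y'(3)
  define z where "z i = (if i \<in> F then x i else 0) - y i" for i
  let ?H = "F \<union> {..N}"
  have "(\<Sum>i\<in>?H. if i \<in> F then x i else 0) = (\<Sum>i\<in>F. x i)"
    using F(1) by (intro sum.mono_neutral_cong_right) auto
  moreover have "(\<Sum>i\<in>?H. y i) = (\<Sum>i\<le>N. y i)"
    using F(1) y(2) by (intro sum.mono_neutral_cong_right) auto
  ultimately have "(\<Sum>i\<in>?H. z i) = 0" unfolding z_def sum_subtractf using y(3) by simp
  moreover have "z i \<in> Rg i" for i
    unfolding z_def using F(2) gideal_subset[OF J y(1)] by (intro Rg_diff) simp_all
  ultimately have "z i = 0" using Rg_direct[of ?H z i] F(1) i by simp
  then show ?thesis using y(1)[of i] i by (simp add: z_def)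
qed

lemma Rtot_inter:
  assumes J: "gideal J"
  shows "Rtot J \<inter> Rg n = J n"
proof
  show "Rtot J \<inter> Rg n \<subseteq> J n"
    using graded_components[OF J, of "{n}" "\<lambda>_. x" n for x] by auto
  show "J n \<subseteq> Rtot J \<inter> Rg n"
    using gideal_subset[OF J] Rtot_base[of _ J n] by auto
qed

lemma Rtot_mono:
  assumes "\<And>n. J n \<subseteq> K n"
  shows "Rtot J \<subseteq> Rtot K"
proof
  fix y assume "y \<in> Rtot J"
  then obtain F x where "finite F" "\<forall>i\<in>F. x i \<in> J i" "y = (\<Sum>i\<in>F. x i)"
    unfolding Rtot_def by (elim CollectE exE conjE)
  then show "y \<in> Rtot K" using assms Rtot_sum[of F x K] by auto
qed

lemma Rtot_add:
  assumes J: "gideal J" and x: "x \<in> Rtot J" and y: "y \<in> Rtot J"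
  shows "x + y \<in> Rtot J"
proof -
  obtain a N where a': "\<forall>i. a i \<in> J i" "\<forall>i>N. a i = 0" "x = (\<Sum>i\<le>N. a i)"
    using Rtot_elem[where J = J, OF gideal_zero[OF J] x] by (elim exE conjE)
  note a = a'(1,2)[rule_format] a'(3)
  obtain b M where b': "\<forall>i. b i \<in> J i" "\<forall>i>M. b i = 0" "y = (\<Sum>i\<le>M. b i)"
    using Rtot_elem[where J = J, OF gideal_zero[OF J] y] by (elim exE conjE)
  note b = b'(1,2)[rule_format] b'(3)
  let ?H = "{..max N M}"
  have "x = (\<Sum>i\<in>?H. a i)"
    unfolding a(3) using a(2) by (intro sum.mono_neutral_left) auto
  moreover have "y = (\<Sum>i\<in>?H. b i)"
    unfolding b(3) using b(2) by (intro sum.mono_neutral_left) auto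
  ultimately have "x + y = (\<Sum>i\<in>?H. a i + b i)" by (simp add: sum.distrib)
  then show ?thesis using Rtot_sum[of ?H "\<lambda>i. a i + b i" J] gideal_add[OF J a(1) b(1)] by simp
qed

lemma Rtot_mult:
  assumes J: "gideal J" and x: "x \<in> Rtot Rg" and y: "y \<in> Rtot J"
  shows "x * y \<in> Rtot J"
proof -
  obtain a N where a': "\<forall>i. a i \<in> Rg i" "\<forall>i>N. a i = 0" "x = (\<Sum>i\<le>N. a i)"
    using Rtot_elem[where J = Rg, OF zero_in_Rg x] by (elim exE conjE)
  note a = a'(1,2)[rule_format] a'(3)
  obtain b M where b': "\<forall>i. b i \<in> J i" "\<forall>i>M. b i = 0" "y = (\<Sum>i\<le>M. b i)"
    using Rtot_elem[where J = J, OF gideal_zero[OF J] y] by (elim exE conjE)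
  note b = b'(1,2)[rule_format] b'(3)
  have sum_closed: "sum h F \<in> Rtot J" if "\<And>i. i \<in> F \<Longrightarrow> h i \<in> Rtot J" for h and F :: "nat set"
    using that
    by (induction F rule: infinite_finite_induct)
      (auto intro: Rtot_add[OF J] Rtot_base[where J = J, OF gideal_zero[OF J, of 0]])
  show ?thesis
    unfolding a(3) b(3) sum_product
    by (intro sum_closed Rtot_base[where J = J, OF gideal_mult[OF J a(1) b(1)]])
qed

lemma is_ideal_Rtot:
  assumes J: "gideal J"
  shows "is_ideal (Rtot Rg) (Rtot J)"
  unfolding is_ideal_def
proof (intro conjI ballI)
  show "Rtot J \<subseteq> Rtot Rg" using gideal_subset[OF J] by (intro Rtot_mono) blast
  show "0 \<in> Rtot J" by (rule Rtot_base[where J = J, OF gideal_zero[OF J, of 0]])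
qed (auto intro: Rtot_add[OF J] Rtot_mult[OF J])

text \<open>The induction runs towards larger ideals. \<open>Rtot\<close> carries an ascending chain
  of graded ideals to one in a Noetherian ring, and \<open>Rtot_inter\<close> recovers the pieces,
  so stabilisation there contradicts strictness here.\<close>

lemma gideal_induct [consumes 1, case_names step]:
  assumes J: "gideal J"
    and step: "\<And>J. gideal J \<Longrightarrow> (\<And>K. gideal K \<Longrightarrow> J < K \<Longrightarrow> P K) \<Longrightarrow> P J"
  shows "P J"
proof -
  let ?r = "{(K, J). gideal J \<and> gideal K \<and> J < K}"
  have "wf ?r"
    unfolding wf_iff_no_infinite_down_chain
  proof (rule notI, elim exE)
    fix f assume f: "\<forall>i. (f (Suc i), f i) \<in> ?r"
    obtain G where G: "finite G" "qalg_gen G = Rtot Rg" by (rule Rtot_fin_type)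
    have "is_ideal (Rtot Rg) (Rtot (f i))" for i using f is_ideal_Rtot by blast
    moreover have "Rtot (f i) \<subseteq> Rtot (f (Suc i))" for i
      using f[rule_format, of i] by (intro Rtot_mono) (auto simp: less_fun_def le_fun_def)
    ultimately obtain N where N: "\<forall>k\<ge>N. Rtot (f k) = Rtot (f N)"
      using noetherian_qalg_gen[OF G(1)] unfolding noetherian_def G(2)
      by (elim allE[of _ "\<lambda>i. Rtot (f i)"]) auto
    have "f (Suc N) n = f N n" for n
      using N Rtot_inter[of "f N" n] Rtot_inter[of "f (Suc N)" n] f
      by (metis (mono_tags, lifting) case_prodD le_SucI mem_Collect_eq order_refl)
    then have "f (Suc N) = f N" by blast
    then show False using f[rule_format, of N] by simp
  qed
  then have "gideal J \<longrightarrow> P J"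
  proof (induction J rule: wf_induct_rule)
    case (less J)
    then show ?case using step[of J] by blast
  qed
  with J show ?thesis by blast
qed

section \<open>Sum and colon ideals of a homogeneous element\<close>

text \<open>The piece of degree \<open>n\<close> of the sum of \<open>J\<close> and the principal
  ideal of \<open>a\<close>. For \<open>n < t\<close> truncated subtraction would yield degree 0, so
  multiples of \<open>a\<close> are excluded explicitly.\<close>

definition gadd :: "(nat \<Rightarrow> 'a set) \<Rightarrow> nat \<Rightarrow> 'a \<Rightarrow> nat \<Rightarrow> 'a set" where
  "gadd J t a n = {x + a * y | x y. x \<in> J n \<and> y \<in> (if t \<le> n then Rg (n - t) else {0})}"

definition gcolon :: "(nat \<Rightarrow> 'a set) \<Rightarrow> nat \<Rightarrow> 'a \<Rightarrow> nat \<Rightarrow> 'a set" where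
  "gcolon J t a n = {y \<in> Rg n. a * y \<in> J (t + n)}"

lemma gideal_gadd:
  assumes J: "gideal J" and a: "a \<in> Rg t"
  shows "gideal (gadd J t a)"
proof -
  define S where "S n = (if t \<le> n then Rg (n - t) else {0})" for n
  have gadd: "gadd J t a n = {x + a * y | x y. x \<in> J n \<and> y \<in> S n}" for n
    unfolding gadd_def S_def by simp
  have S0: "0 \<in> S n" for n by (simp add: S_def)
  have aS: "a * y \<in> Rg n" if "y \<in> S n" for y n
    using that Rg_mult[OF a, of y "n - t"] by (auto simp: S_def split: if_splits)
  have Sadd: "x + y \<in> S n" if "x \<in> S n" "y \<in> S n" for x y n
    using that Rg_add by (auto simp: S_def split: if_splits)
  have Smult: "x * y \<in> S (m + n)" if "x \<in> Rg m" "y \<in> S n" for x y m n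
    using that Rg_mult[of x m y "n - t"] by (auto simp: S_def split: if_splits)
  show ?thesis
    unfolding gideal_def
  proof (intro conjI allI ballI)
    fix n
    show "gadd J t a n \<subseteq> Rg n"
      unfolding gadd using gideal_subset[OF J] aS Rg_add by blast
    show "0 \<in> gadd J t a n"
      unfolding gadd using gideal_zero[OF J, of n] S0[of n] by force
    show "x + y \<in> gadd J t a n" if x: "x \<in> gadd J t a n" and y: "y \<in> gadd J t a n" for x y
    proof -
      obtain x1 x2 where x12: "x = x1 + a * x2" "x1 \<in> J n" "x2 \<in> S n" using x unfolding gadd by blast
      obtain y1 y2 where y12: "y = y1 + a * y2" "y1 \<in> J n" "y2 \<in> S n" using y unfolding gadd by blast
      have "x + y = (x1 + y1) + a * (x2 + y2)" using x12 y12 by (simp add: algebra_simps)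
      then show ?thesis
        unfolding gadd using gideal_add[OF J x12(2) y12(2)] Sadd[OF x12(3) y12(3)] by blast
    qed
  next
    fix m n x y assume x: "x \<in> Rg m" and y: "y \<in> gadd J t a n"
    obtain y1 y2 where y12: "y = y1 + a * y2" "y1 \<in> J n" "y2 \<in> S n" using y unfolding gadd by blast
    have "x * y = x * y1 + a * (x * y2)" using y12 by (simp add: algebra_simps)
    then show "x * y \<in> gadd J t a (m + n)"
      unfolding gadd using gideal_mult[OF J x y12(2)] Smult[OF x y12(3)] by blast
  qed
qed

lemma gideal_gcolon:
  assumes J: "gideal J" and a: "a \<in> Rg t"
  shows "gideal (gcolon J t a)"
  unfolding gideal_def
proof (intro conjI allI ballI)
  fix n
  show "gcolon J t a n \<subseteq> Rg n" "0 \<in> gcolon J t a n"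
    unfolding gcolon_def by (auto simp: gideal_zero[OF J])
  show "x + y \<in> gcolon J t a n" if "x \<in> gcolon J t a n" "y \<in> gcolon J t a n" for x y
    using that unfolding gcolon_def by (auto simp: distrib_left intro: Rg_add gideal_add[OF J])
next
  fix m n x y assume x: "x \<in> Rg m" and y: "y \<in> gcolon J t a n"
  then have "x * (a * y) \<in> J (m + (t + n))"
    by (intro gideal_mult[OF J x]) (simp add: gcolon_def)
  then show "x * y \<in> gcolon J t a (m + n)"
    using x y Rg_mult[OF x, of y n] unfolding gcolon_def by (simp add: ac_simps)
qed

lemma gadd_greater:
  assumes J: "gideal J" and a: "a \<in> Rg t" "a \<notin> J t"
  shows "J < gadd J t a"
proof -
  have "x \<in> gadd J t a n" if "x \<in> J n" for x n
    unfolding gadd_def using that by (intro CollectI exI[of _ x] exI[of _ "0::'a"]) simp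
  then have "J \<le> gadd J t a" by (auto simp: le_fun_def)
  moreover have "a \<in> gadd J t a t"
    unfolding gadd_def using one_in_Rg gideal_zero[OF J, of t]
    by (intro CollectI exI[of _ "0::'a"] exI[of _ "1::'a"]) simp
  ultimately show ?thesis using a(2) by (metis order_le_less)
qed

lemma gcolon_greater:
  assumes J: "gideal J" and a: "a \<in> Rg t" and b: "b \<in> Rg r" "b \<notin> J r" and ab: "a * b \<in> J (t + r)"
  shows "J < gcolon J t a"
proof -
  have "J \<le> gcolon J t a"
    unfolding gcolon_def le_fun_def using gideal_subset[OF J] gideal_mult[OF J a] by auto
  moreover have "b \<in> gcolon J t a r" unfolding gcolon_def using b ab by simp
  ultimately show ?thesis using b(2) by (metis order_le_less)
qed

section \<open>Graded primes and the dimension of Proj\<close>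

text \<open>Tested on homogeneous elements only, so that a failure yields a homogeneous zero divisor
  for the filtration; \<open>Rtot_prime\<close> shows that this is primality in
  \<open>R\<close>.\<close>

definition gprime :: "(nat \<Rightarrow> 'a set) \<Rightarrow> bool" where
  "gprime J \<longleftrightarrow> gideal J \<and> 1 \<notin> J 0 \<and>
     (\<forall>m n. \<forall>x\<in>Rg m. \<forall>y\<in>Rg n. x * y \<in> J (m + n) \<longrightarrow> x \<in> J m \<or> y \<in> J n)"

text \<open>For two elements outside the ideal, the product of their highest components outside the
  ideal is, modulo the ideal, a component of the product.\<close>

lemma Rtot_prime:
  assumes P: "gprime J" and x: "x \<in> Rtot Rg" and y: "y \<in> Rtot Rg" and xy: "x * y \<in> Rtot J"
  shows "x \<in> Rtot J \<or> y \<in> Rtot J"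
proof (rule ccontr)
  assume neg: "\<not> (x \<in> Rtot J \<or> y \<in> Rtot J)"
  have J: "gideal J" using P by (simp add: gprime_def)
  obtain a N where a': "\<forall>i. a i \<in> Rg i" "\<forall>i>N. a i = 0" "x = (\<Sum>i\<le>N. a i)"
    using Rtot_elem[where J = Rg, OF zero_in_Rg x] by (elim exE conjE)
  note a = a'(1,2)[rule_format] a'(3)
  obtain b M where b': "\<forall>i. b i \<in> Rg i" "\<forall>i>M. b i = 0" "y = (\<Sum>i\<le>M. b i)"
    using Rtot_elem[where J = Rg, OF zero_in_Rg y] by (elim exE conjE)
  note b = b'(1,2)[rule_format] b'(3)
  have top: "\<exists>p\<le>K. h p \<notin> J p \<and> (\<forall>i>p. h i \<in> J i)"
    if h: "\<And>i. K < i \<Longrightarrow> h i = 0" and sum: "(\<Sum>i\<le>K. h i) \<notin> Rtot J" for h K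
  proof -
    let ?T = "{p. p \<le> K \<and> h p \<notin> J p}"
    have "?T \<noteq> {}" using sum Rtot_sum[of "{..K}" h J] by fastforce
    moreover have "finite ?T" by simp
    ultimately have "Max ?T \<in> ?T" and "\<forall>i\<in>?T. i \<le> Max ?T" by (auto simp del: mem_Collect_eq)
    moreover have "h i \<in> J i" if "i > K" for i using h[OF that] gideal_zero[OF J] by simp
    ultimately show ?thesis by (metis (mono_tags, lifting) leD leI mem_Collect_eq)
  qed
  obtain p where p: "p \<le> N" "a p \<notin> J p" "\<And>i. i > p \<Longrightarrow> a i \<in> J i"
    using top[of N a] a(2,3) neg by blast
  obtain q where q: "q \<le> M" "b q \<notin> J q" "\<And>i. i > q \<Longrightarrow> b i \<in> J i"
    using top[of M b] b(2,3) neg by blast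
  define z where "z r = (\<Sum>k\<le>r. a k * b (r - k))" for r
  have ab: "a k * b (r - k) \<in> Rg r" if "k \<le> r" for k r
    using Rg_mult[OF a(1)[of k] b(1)[of "r - k"]] that by simp
  \<comment> \<open>The product formula for polynomials, evaluated at 1, groups the product by total
    degree.\<close>
  have "x * y = (\<Sum>r\<le>N + M. z r)"
    using polynomial_product[of N a M b 1] a b unfolding z_def by simp
  moreover have "z r \<in> Rg r" for r
    unfolding z_def by (intro gideal_sum[OF gideal_Rg] ab) simp
  ultimately have "z (p + q) \<in> J (p + q)"
    using graded_components[OF J, of "{..N + M}" z "p + q"] xy p(1) q(1) by simp
  moreover have "(\<Sum>k\<in>{..p+q} - {p}. a k * b (p + q - k)) \<in> J (p + q)"
  proof (rule gideal_sum[OF J])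
    fix k assume k: "k \<in> {..p+q} - {p}"
    show "a k * b (p + q - k) \<in> J (p + q)"
    proof (cases "k < p")
      case True
      then have "b (p + q - k) \<in> J (p + q - k)" by (intro q(3)) linarith
      from gideal_mult[OF J a(1) this, of k] show ?thesis using k by simp
    next
      case False
      then have "a k \<in> J k" using k by (intro p(3)) auto
      from gideal_mult[OF J b(1) this, of "p + q - k"] show ?thesis using k by (simp add: mult.commute)
    qed
  qed
  moreover have "z (p + q) = a p * b q + (\<Sum>k\<in>{..p+q} - {p}. a k * b (p + q - k))"
    unfolding z_def by (subst sum.remove[of _ p]) auto
  ultimately have "a p * b q + (\<Sum>k\<in>{..p+q} - {p}. a k * b (p + q - k))
      - (\<Sum>k\<in>{..p+q} - {p}. a k * b (p + q - k)) \<in> J (p + q)"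
    by (intro gideal_diff[OF J]) simp_all
  then have "a p * b q \<in> J (p + q)" by simp
  then show False using P a(1) b(1) p(2) q(2) unfolding gprime_def by blast
qed

lemma Rtot_in_subvarieties:
  assumes P: "gprime J" and rel: "\<not> (\<forall>n\<ge>1. Rg n \<subseteq> J n)"
  shows "Rtot J \<in> subvarieties Rg"
proof -
  have J: "gideal J" using P by (simp add: gprime_def)
  have I: "is_ideal (Rtot Rg) (Rtot J)" by (rule is_ideal_Rtot[OF J])
  have "1 \<notin> Rtot J" using P Rtot_inter[OF J, of 0] one_in_Rg unfolding gprime_def by blast
  moreover have "\<not> (\<forall>n\<ge>1. Rg n \<subseteq> Rtot J)" using rel Rtot_inter[OF J] by blast
  moreover have "x i \<in> Rtot J"
    if "finite F" "\<forall>i\<in>F. x i \<in> Rg i" "(\<Sum>i\<in>F. x i) \<in> Rtot J" "i \<in> F" for F x i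
    using graded_components[OF J, of F x i] that Rtot_base[of "x i" J i] by blast
  ultimately show ?thesis
    using I Rtot_prime[OF P] unfolding subvarieties_def relevant_hom_prime_def is_ideal_def by auto
qed

lemma subvarieties_prime: "P \<in> subvarieties Rg \<Longrightarrow> is_prime_ideal (Rtot Rg) P"
  unfolding subvarieties_def relevant_hom_prime_def is_prime_ideal_def is_ideal_def by simp

lemma prime_chain_le_dimProj:
  assumes "prime_chain Rg k c"
  shows "k \<le> dimProj Rg"
proof -
  obtain G where G: "finite G" "qalg_gen G = Rtot Rg" by (rule Rtot_fin_type)
  let ?S = "{k. \<exists>c. prime_chain Rg k c}"
  have "l \<le> card G" if "l \<in> ?S" for l
    using that prime_chain_length[OF G(1), of l] subvarieties_prime unfolding prime_chain_def G(2)
    by blast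
  then have "bdd_above ?S" by (rule bdd_aboveI)
  moreover have "k \<in> ?S" using assms by blast
  ultimately have "k \<le> Sup ?S" by (intro cSup_upper)
  then show ?thesis unfolding dimProj_def prime_chain_def .
qed

end

section \<open>Covering radii\<close>

text \<open>Multiplication by an element of degree \<open>t\<close> shifts the sequence of radii by
  \<open>t\<close>; partial sums of nonnegative terms do not grow under such a shift.\<close>

lemma sum_shift_le:
  fixes g :: "nat \<Rightarrow> real"
  assumes "\<And>j. 0 \<le> g j"
  shows "(\<Sum>i\<le>n. if t \<le> i then g (i - t) else 0) \<le> (\<Sum>j\<le>n. g j)"
proof -
  have "(\<Sum>i\<le>n. if t \<le> i then g (i - t) else 0) = (if t \<le> n then \<Sum>j\<le>n - t. g j else 0)"
    by (induction n) (auto simp: Suc_diff_le le_Suc_eq)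
  also have "\<dots> \<le> (\<Sum>j\<le>n. g j)"
    using assms by (auto intro!: sum_mono2 sum_nonneg)
  finally show ?thesis .
qed

locale normed_graded = graded_alg Rg for Rg :: "nat \<Rightarrow> 'a::field_char_0 set" +
  fixes Zg :: "nat \<Rightarrow> 'a set"
    and V :: "nat \<Rightarrow> 'v::real_vector set"
    and iota :: "nat \<Rightarrow> 'a \<Rightarrow> 'v"
    and nrm :: "nat \<Rightarrow> 'v \<Rightarrow> real"
    and upsilon :: "'a set \<Rightarrow> real"
  assumes Z: "integral_structure Rg Zg"
    and bc: "\<forall>n. real_base_change (Rg n) (V n) (iota n)"
    and nm: "\<forall>n. is_norm_on (V n) (nrm n)"
    and submult: "\<forall>n n'. \<forall>a\<in>Zg n. \<forall>b\<in>Zg n'.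
        nrm (n + n') (iota (n + n') (a * b)) \<le> nrm n (iota n a) * nrm n' (iota n' b)"
    and ups_pos: "\<forall>Y\<in>subvarieties Rg. upsilon Y > 0"
    and ups: "\<forall>Y\<in>subvarieties Rg. \<exists>n\<ge>1. \<exists>s\<in>Zg n. s \<notin> Y \<and>
        quot_norm (Rg n) Y (iota n) (nrm n) s \<le> upsilon Y ^ n"
begin

section \<open>The norm on rational vectors\<close>

definition anorm :: "nat \<Rightarrow> 'a \<Rightarrow> real" where
  "anorm n x = nrm n (iota n x)"

lemma Zg_Rg: "x \<in> Zg n \<Longrightarrow> x \<in> Rg n"
  and Zg_zspan: "zspan (Zg n) = Zg n"
  and Zg_fin_gen: "\<exists>G. finite G \<and> G \<subseteq> Zg n \<and> zspan G = Zg n"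
  and Zg_qspan: "qspan (Zg n) = Rg n"
  and Zg_mult: "x \<in> Zg m \<Longrightarrow> y \<in> Zg n \<Longrightarrow> x * y \<in> Zg (m + n)"
  using Z unfolding integral_structure_def by auto

lemma Zg_subspace: "Zmod.subspace (Zg n)"
  using Zg_zspan[of n] unfolding zspan_eq_span by (metis Zmod.subspace_span)

lemma Zg_add: "x \<in> Zg n \<Longrightarrow> y \<in> Zg n \<Longrightarrow> x + y \<in> Zg n"
  by (rule Zmod.subspace_add[OF Zg_subspace])

lemma Zg_diff: "x \<in> Zg n \<Longrightarrow> y \<in> Zg n \<Longrightarrow> x - y \<in> Zg n"
  by (rule Zmod.subspace_diff[OF Zg_subspace])

lemma Zg_zero: "0 \<in> Zg n"
  by (rule Zmod.subspace_0[OF Zg_subspace])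

lemma Zg_scale: "x \<in> Zg n \<Longrightarrow> of_int k * x \<in> Zg n"
  by (rule Zmod.subspace_scale[OF Zg_subspace])

lemma V_eq: "V n = span (iota n ` Rg n)"
  and iota_add: "x \<in> Rg n \<Longrightarrow> y \<in> Rg n \<Longrightarrow> iota n (x + y) = iota n x + iota n y"
  and iota_scale: "x \<in> Rg n \<Longrightarrow> iota n (of_rat q * x) = real_of_rat q *\<^sub>R iota n x"
  using bc[rule_format, of n] unfolding real_base_change_def by (elim conjE, blast)+

lemma iota_V: "x \<in> Rg n \<Longrightarrow> iota n x \<in> V n"
  unfolding V_eq by (intro span_base imageI)

lemma V_subspace: "subspace (V n)"
  unfolding V_eq by simp

lemma nrm_nonneg: "v \<in> V n \<Longrightarrow> 0 \<le> nrm n v"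
  and nrm_zero_iff: "v \<in> V n \<Longrightarrow> nrm n v = 0 \<longleftrightarrow> v = 0"
  and nrm_scale: "v \<in> V n \<Longrightarrow> nrm n (c *\<^sub>R v) = \<bar>c\<bar> * nrm n v"
  and nrm_add: "v \<in> V n \<Longrightarrow> w \<in> V n \<Longrightarrow> nrm n (v + w) \<le> nrm n v + nrm n w"
  using nm[rule_format, of n] unfolding is_norm_on_def by auto

lemma nrm_zero: "nrm n 0 = 0"
  using nrm_zero_iff[OF subspace_0[OF V_subspace]] by simp

lemma anorm_nonneg: "x \<in> Rg n \<Longrightarrow> 0 \<le> anorm n x"
  unfolding anorm_def by (intro nrm_nonneg iota_V)

lemma anorm_add: "x \<in> Rg n \<Longrightarrow> y \<in> Rg n \<Longrightarrow> anorm n (x + y) \<le> anorm n x + anorm n y"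
  unfolding anorm_def iota_add by (intro nrm_add iota_V)

lemma anorm_scale: "x \<in> Rg n \<Longrightarrow> anorm n (of_rat q * x) = \<bar>real_of_rat q\<bar> * anorm n x"
  unfolding anorm_def iota_scale by (intro nrm_scale iota_V)

lemma anorm_zero: "anorm n 0 = 0"
  using anorm_scale[OF zero_in_Rg, of n 0] by simp

lemma anorm_minus: "x \<in> Rg n \<Longrightarrow> anorm n (- x) = anorm n x"
  using anorm_scale[of x n "-1"] by simp

lemma anorm_sum_le: "(\<And>i. i \<in> F \<Longrightarrow> x i \<in> Rg n) \<Longrightarrow> anorm n (sum x F) \<le> (\<Sum>i\<in>F. anorm n (x i))"
proof (induction F rule: infinite_finite_induct)
  case (insert i F)
  have "anorm n (x i + sum x F) \<le> anorm n (x i) + anorm n (sum x F)"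
    using insert.prems by (intro anorm_add gideal_sum[OF gideal_Rg]) auto
  then show ?case using insert by simp
qed (simp_all add: anorm_zero)

text \<open>Serves two purposes: extending submultiplicativity from \<open>Zg\<close> to
  \<open>Rg\<close>, and making zero divisors integral.\<close>

lemma clear_denominator:
  assumes "x \<in> Rg n"
  shows "\<exists>D::int. D > 0 \<and> of_int D * x \<in> Zg n"
proof -
  have "x \<in> Qvec.span (Zg n)" using assms Zg_qspan[of n] by (simp add: qspan_eq_span)
  then show ?thesis
  proof (induction rule: Qvec.span_induct_alt)
    case base
    then show ?case using Zg_zero by (auto intro: exI[of _ 1])
  next
    case (step c x y)
    then obtain D where D: "D > 0" "of_int D * y \<in> Zg n" by blast
    obtain a b where ab: "quotient_of c = (a, b)" by fastforce
    then have b: "b > 0" and c: "c = of_int a / of_int b"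
      using quotient_of_denom_pos quotient_of_div by blast+
    have "of_rat c = (of_int a / of_int b :: 'a)" unfolding c by (simp add: of_rat_divide)
    then have "of_int (D * b) * (of_rat c * x + y) = of_int (D * a) * x + of_int b * (of_int D * y)"
      using b by (simp add: field_simps)
    also have "\<dots> \<in> Zg n" by (intro Zg_add Zg_scale step D)
    finally show ?case using b D by (intro exI[of _ "D * b"]) simp
  qed
qed

text \<open>Both sides are homogeneous in each factor, so the inequality for lattice elements
  survives division by the cleared denominators.\<close>

lemma anorm_mult:
  assumes x: "x \<in> Rg m" and y: "y \<in> Rg n"
  shows "anorm (m + n) (x * y) \<le> anorm m x * anorm n y"
proof -
  obtain D :: int where D: "D > 0" "of_int D * x \<in> Zg m" using clear_denominator[OF x] by blast
  obtain E :: int where E: "E > 0" "of_int E * y \<in> Zg n" using clear_denominator[OF y] by blast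
  have fi: "anorm k (of_int C * z) = real_of_int C * anorm k z" if "C > 0" "z \<in> Rg k" for C k z
    using anorm_scale[OF that(2), of "of_int C"] that(1) by simp
  have "anorm (m + n) ((of_int D * x) * (of_int E * y)) \<le> anorm m (of_int D * x) * anorm n (of_int E * y)"
    using submult D(2) E(2) unfolding anorm_def by blast
  also have "\<dots> = real_of_int (D * E) * (anorm m x * anorm n y)"
    by (simp add: fi[OF D(1) x] fi[OF E(1) y])
  also have "(of_int D * x) * (of_int E * y) = of_int (D * E) * (x * y)" by simp
  also have "anorm (m + n) \<dots> = real_of_int (D * E) * anorm (m + n) (x * y)"
    using D E by (intro fi Rg_mult x y) simp
  finally show ?thesis using D E by (simp add: mult_le_cancel_left_pos)
qed

text \<open>The image of \<open>Zg n\<close> in \<open>Rg n / J n\<close> has covering radius at most \<open>r\<close> in the quotient norm,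
  tested on rational vectors only, so that multiplication by ring elements makes sense.\<close>

definition Cov :: "(nat \<Rightarrow> 'a set) \<Rightarrow> nat \<Rightarrow> real \<Rightarrow> bool" where
  "Cov J n r \<longleftrightarrow> (\<forall>x\<in>Rg n. \<exists>z\<in>Zg n. \<exists>p\<in>J n. anorm n (x - z - p) \<le> r)"

lemma CovD:
  assumes "Cov J n r" "x \<in> Rg n"
  obtains z p where "z \<in> Zg n" "p \<in> J n" "anorm n (x - z - p) \<le> r"
  using assms unfolding Cov_def by blast

lemma Cov_mono: "Cov J n r \<Longrightarrow> r \<le> r' \<Longrightarrow> Cov J n r'"
  unfolding Cov_def by (meson order_trans)

text \<open>Rounding down the coefficients over finitely many generators of \<open>Zg n\<close>
  leaves coefficients of absolute value at most 1; the correction from \<open>J n\<close> is taken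
  to be 0.\<close>

lemma Cov_exists:
  assumes J: "gideal J"
  shows "\<exists>r\<ge>0. Cov J n r"
proof -
  obtain G where G: "finite G" "G \<subseteq> Zg n" "zspan G = Zg n" using Zg_fin_gen by blast
  have GR: "g \<in> Rg n" if "g \<in> G" for g using G(2) Zg_Rg that by blast
  have "Zg n \<subseteq> Qvec.span G"
  proof
    fix x assume "x \<in> Zg n"
    then obtain F c where F: "finite F" "F \<subseteq> G" "x = (\<Sum>v\<in>F. of_int (c v) * v)"
      using G(3) unfolding zspan_def by blast
    have "of_rat (of_int (c v)) * v \<in> Qvec.span G" if "v \<in> F" for v
      using that F(2) by (intro Qvec.span_scale Qvec.span_base) auto
    then show "x \<in> Qvec.span G" unfolding F(3) by (intro Qvec.span_sum) simp
  qed
  then have RG: "Rg n \<subseteq> Qvec.span G"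
    using Qvec.span_minimal[OF _ Qvec.subspace_span] Zg_qspan[of n] unfolding qspan_eq_span by metis
  have "Cov J n (\<Sum>g\<in>G. anorm n g)"
    unfolding Cov_def
  proof
    fix x assume "x \<in> Rg n"
    then obtain c where c: "x = (\<Sum>g\<in>G. of_rat (c g) * g)"
      using RG Qvec.span_finite[OF G(1)] by blast
    define z where "z = (\<Sum>g\<in>G. of_int \<lfloor>c g\<rfloor> * g)"
    have z: "z \<in> Zg n"
      unfolding z_def using G(2) by (intro Zmod.subspace_sum[OF Zg_subspace] Zg_scale) auto
    have xz: "x - z = (\<Sum>g\<in>G. of_rat (c g - of_int \<lfloor>c g\<rfloor>) * g)"
      unfolding c z_def sum_subtractf[symmetric] by (simp add: of_rat_diff left_diff_distrib)
    have "anorm n (of_rat (c g - of_int \<lfloor>c g\<rfloor>) * g) \<le> anorm n g" if g: "g \<in> G" for g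
    proof -
      have "\<bar>c g - of_int \<lfloor>c g\<rfloor>\<bar> \<le> 1" by linarith
      then have "\<bar>real_of_rat (c g - of_int \<lfloor>c g\<rfloor>)\<bar> \<le> 1"
        by (metis of_rat_1 of_rat_less_eq abs_of_rat)
      then have "\<bar>real_of_rat (c g - of_int \<lfloor>c g\<rfloor>)\<bar> * anorm n g \<le> 1 * anorm n g"
        by (intro mult_right_mono anorm_nonneg GR g)
      then show ?thesis unfolding anorm_scale[OF GR[OF g]] by simp
    qed
    then have "anorm n (x - z) \<le> (\<Sum>g\<in>G. anorm n g)"
      unfolding xz by (intro order_trans[OF anorm_sum_le] sum_mono Rg_scale GR)
    then show "\<exists>z\<in>Zg n. \<exists>p\<in>J n. anorm n (x - z - p) \<le> (\<Sum>g\<in>G. anorm n g)"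
      using z gideal_zero[OF J] by (metis diff_zero)
  qed
  moreover have "0 \<le> (\<Sum>g\<in>G. anorm n g)" by (intro sum_nonneg anorm_nonneg GR)
  ultimately show ?thesis by blast
qed

lemma Cov_trivial:
  assumes "Rg n \<subseteq> J n"
  shows "Cov J n 0"
  unfolding Cov_def
proof
  fix x assume "x \<in> Rg n"
  then show "\<exists>z\<in>Zg n. \<exists>p\<in>J n. anorm n (x - z - p) \<le> 0"
    using assms by (intro bexI[of _ 0] bexI[of _ x]) (auto simp: anorm_zero Zg_zero)
qed

text \<open>Subadditivity along multiplication by \<open>a\<close>. Approximating \<open>x\<close>
  modulo \<open>gadd J t a\<close> leaves a multiple \<open>a * y\<close>, and approximating
  \<open>y\<close> modulo \<open>K\<close> leaves \<open>a * e\<close>, which may be replaced by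
  \<open>a' * e\<close> modulo \<open>J\<close>. Two representatives occur because \<open>a\<close>
  must be integral to carry lattice vectors to lattice vectors, while \<open>a'\<close> only has to
  be small. \<open>K\<close> is the colon ideal in the filtration step and \<open>J\<close> itself
  for primes.\<close>

lemma Cov_step:
  assumes J: "gideal J" and K: "gideal K" and a: "a \<in> Zg t" and a': "a' \<in> Rg t" "a - a' \<in> J t" "anorm t a' \<le> c"
    and KJ: "\<And>y. y \<in> K (n - t) \<Longrightarrow> a * y \<in> J (t + (n - t))" and tn: "t \<le> n"
    and r1: "Cov (gadd J t a) n r1" and r2: "Cov K (n - t) r2"
  shows "Cov J n (r1 + c * r2)"
  unfolding Cov_def
proof
  fix x assume x: "x \<in> Rg n"
  have n: "t + (n - t) = n" using tn by simp
  obtain z q where z: "z \<in> Zg n" "q \<in> gadd J t a n" "anorm n (x - z - q) \<le> r1" by (rule CovD[OF r1 x])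
  obtain p y where p: "q = p + a * y" "p \<in> J n" "y \<in> Rg (n - t)"
    using z(2) tn unfolding gadd_def by auto
  obtain z' p' where z': "z' \<in> Zg (n - t)" "p' \<in> K (n - t)" "anorm (n - t) (y - z' - p') \<le> r2"
    by (rule CovD[OF r2 p(3)])
  define e where "e = y - z' - p'"
  have e: "e \<in> Rg (n - t)"
    unfolding e_def by (intro Rg_diff p Zg_Rg z' gideal_subset[OF K])
  have aR: "a \<in> Rg t" by (rule Zg_Rg[OF a])
  have "q \<in> Rg n"
    using gideal_subset[OF gideal_gadd[OF J aR] z(2)] .
  then have xzq: "x - z - q \<in> Rg n" by (intro Rg_diff[OF Rg_diff[OF x Zg_Rg[OF z(1)]]])
  have az: "z + a * z' \<in> Zg n" using Zg_mult[OF a z'(1)] z(1) Zg_add n by simp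
  have "(a - a') * e \<in> J n" using gideal_mult[OF J e a'(2)] tn by (simp add: mult.commute)
  then have ap: "p + a * p' + (a - a') * e \<in> J n"
    using KJ[OF z'(2)] p(2) n by (intro gideal_add[OF J]) auto
  have a'e: "a' * e \<in> Rg n" using Rg_mult[OF a'(1) e] n by simp
  have "x - (z + a * z') - (p + a * p' + (a - a') * e) = (x - z - q) + a' * e"
    unfolding p(1) e_def by (simp add: algebra_simps)
  then have "anorm n (x - (z + a * z') - (p + a * p' + (a - a') * e)) \<le> anorm n (x - z - q) + anorm n (a' * e)"
    using anorm_add[OF xzq a'e] by (simp only:)
  also have "anorm n (a' * e) \<le> anorm t a' * anorm (n - t) e" using anorm_mult[OF a'(1) e] n by simp
  also have "\<dots> \<le> c * anorm (n - t) e" by (intro mult_right_mono a' anorm_nonneg e)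
  also have "\<dots> \<le> c * r2"
    using z'(3) anorm_nonneg[OF a'(1)] a'(3) unfolding e_def by (intro mult_left_mono) auto
  finally have "anorm n (x - (z + a * z') - (p + a * p' + (a - a') * e)) \<le> r1 + c * r2"
    using z(3) by simp
  then show "\<exists>z\<in>Zg n. \<exists>p\<in>J n. anorm n (x - z - p) \<le> r1 + c * r2" using az ap by blast
qed

lemma Cov_gadd_low:
  assumes "n < t" "Cov (gadd J t a) n r"
  shows "Cov J n r"
proof -
  have "gadd J t a n = J n" using assms(1) unfolding gadd_def by auto
  then show ?thesis using assms(2) unfolding Cov_def by simp
qed

section \<open>Growth of covering radii\<close>

text \<open>Only the value of the maximum travels through the induction; the sets of two branches
  are merged by \<open>max_upsilon_max\<close>. Nonemptiness makes \<open>M\<close> positive, so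
  that division by \<open>M ^ i\<close> makes sense.\<close>

definition max_upsilon :: "real \<Rightarrow> bool" where
  "max_upsilon M \<longleftrightarrow> (\<exists>S. finite S \<and> S \<noteq> {} \<and> S \<subseteq> subvarieties Rg \<and> M = Max (upsilon ` S))"

lemma max_upsilon_pos: "max_upsilon M \<Longrightarrow> 0 < M"
  unfolding max_upsilon_def
proof (elim exE conjE)
  fix S assume S: "finite S" "S \<noteq> {}" "S \<subseteq> subvarieties Rg" "M = Max (upsilon ` S)"
  then have "M \<in> upsilon ` S" using Max_in[of "upsilon ` S"] by simp
  then show "0 < M" using S(3) ups_pos by auto
qed

lemma max_upsilon_max: "max_upsilon M \<Longrightarrow> max_upsilon M' \<Longrightarrow> max_upsilon (max M M')"
  unfolding max_upsilon_def
proof (elim exE conjE)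
  fix S T assume "finite S" "S \<noteq> {}" "S \<subseteq> subvarieties Rg" "M = Max (upsilon ` S)"
    "finite T" "T \<noteq> {}" "T \<subseteq> subvarieties Rg" "M' = Max (upsilon ` T)"
  then show "\<exists>S. finite S \<and> S \<noteq> {} \<and> S \<subseteq> subvarieties Rg \<and> max M M' = Max (upsilon ` S)"
    by (intro exI[of _ "S \<union> T"]) (simp add: image_Un Max_Un)
qed

lemma max_upsilon_single: "Y \<in> subvarieties Rg \<Longrightarrow> max_upsilon (upsilon Y)"
  unfolding max_upsilon_def by (intro exI[of _ "{Y}"]) simp

text \<open>Polynomial growth is imposed on partial sums rather than on the individual radii: this
  makes the exponent \<open>0\<close> express that the radii vanish in large degrees up to a summable
  error, so that irrelevant ideals need no separate treatment.\<close>

definition cov_growth :: "(nat \<Rightarrow> 'a set) \<Rightarrow> nat \<Rightarrow> bool" where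
  "cov_growth J k \<longleftrightarrow> (\<exists>M B u. max_upsilon M \<and> 0 \<le> B \<and> (\<forall>n. 0 \<le> u n \<and> Cov J n (u n)) \<and>
     (\<forall>n. (\<Sum>i\<le>n. u i / M ^ i) \<le> B * (real n + 1) ^ k))"

text \<open>Enlarging \<open>M\<close> shrinks the weights, so the bound is handed out for all
  larger \<open>M'\<close>; estimates from different branches can then use a common maximum.\<close>

lemma cov_growthE:
  assumes "cov_growth J k"
  obtains M B u where "max_upsilon M" "0 \<le> B" "\<And>n. 0 \<le> u n" "\<And>n. Cov J n (u n)"
    "\<And>n M'. M \<le> M' \<Longrightarrow> (\<Sum>i\<le>n. u i / M' ^ i) \<le> B * (real n + 1) ^ k"
proof -
  obtain M B u where *: "max_upsilon M" "0 \<le> B" "\<forall>n. 0 \<le> u n \<and> Cov J n (u n)"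
    "\<forall>n. (\<Sum>i\<le>n. u i / M ^ i) \<le> B * (real n + 1) ^ k"
    using assms unfolding cov_growth_def by (elim exE conjE)
  have "(\<Sum>i\<le>n. u i / M' ^ i) \<le> B * (real n + 1) ^ k" if "M \<le> M'" for n M'
  proof -
    have "(\<Sum>i\<le>n. u i / M' ^ i) \<le> (\<Sum>i\<le>n. u i / M ^ i)"
      using *(3) that max_upsilon_pos[OF *(1)]
      by (intro sum_mono divide_left_mono power_mono mult_pos_pos zero_less_power) auto
    then show ?thesis using *(4) order_trans by blast
  qed
  then show ?thesis using that * by blast
qed

text \<open>The norm of \<open>a\<close> may be arbitrarily large: \<open>a\<close> is used once, so
  its norm enters the constant and leaves the exponent \<open>k\<close> alone.\<close>

lemma cov_growth_filtration:
  assumes J: "gideal J" and a: "a \<in> Zg t"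
    and add: "cov_growth (gadd J t a) k" and colon: "cov_growth (gcolon J t a) k"
  shows "cov_growth J k"
proof -
  obtain M1 B1 u1 where 1: "max_upsilon M1" "0 \<le> B1" "\<And>n. 0 \<le> u1 n" "\<And>n. Cov (gadd J t a) n (u1 n)"
    "\<And>n M'. M1 \<le> M' \<Longrightarrow> (\<Sum>i\<le>n. u1 i / M' ^ i) \<le> B1 * (real n + 1) ^ k"
    by (rule cov_growthE[OF add]) blast
  obtain M2 B2 u2 where 2: "max_upsilon M2" "0 \<le> B2" "\<And>n. 0 \<le> u2 n" "\<And>n. Cov (gcolon J t a) n (u2 n)"
    "\<And>n M'. M2 \<le> M' \<Longrightarrow> (\<Sum>i\<le>n. u2 i / M' ^ i) \<le> B2 * (real n + 1) ^ k"
    by (rule cov_growthE[OF colon]) blast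
  define M where "M = max M1 M2"
  have M: "max_upsilon M" "M > 0" unfolding M_def using max_upsilon_max[OF 1(1) 2(1)] max_upsilon_pos by blast+
  have aR: "a \<in> Rg t" by (rule Zg_Rg[OF a])
  define c where "c = anorm t a"
  have c: "0 \<le> c" unfolding c_def by (rule anorm_nonneg[OF aR])
  define u where "u n = u1 n + (if t \<le> n then c * u2 (n - t) else 0)" for n
  have cov: "Cov J n (u n)" for n
  proof (cases "t \<le> n")
    case True
    have "Cov J n (u1 n + c * u2 (n - t))"
      by (rule Cov_step[OF J gideal_gcolon[OF J aR] a aR _ _ _ True 1(4) 2(4)])
        (auto simp: gcolon_def c_def gideal_zero[OF J])
    then show ?thesis using True by (simp add: u_def)
  next
    case False
    then show ?thesis using Cov_gadd_low[OF _ 1(4)] by (simp add: u_def)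
  qed
  have "(\<Sum>i\<le>n. u i / M ^ i) \<le> (B1 + c / M ^ t * B2) * (real n + 1) ^ k" for n
  proof -
    have "u i / M ^ i = u1 i / M ^ i + (c / M ^ t) * (if t \<le> i then u2 (i - t) / M ^ (i - t) else 0)" for i
      using M(2) by (auto simp: u_def add_divide_distrib power_add[symmetric])
    then have "(\<Sum>i\<le>n. u i / M ^ i) = (\<Sum>i\<le>n. u1 i / M ^ i)
        + (c / M ^ t) * (\<Sum>i\<le>n. if t \<le> i then u2 (i - t) / M ^ (i - t) else 0)"
      by (simp add: sum.distrib sum_distrib_left)
    also have "\<dots> \<le> B1 * (real n + 1) ^ k + (c / M ^ t) * (B2 * (real n + 1) ^ k)"
    proof (intro add_mono mult_left_mono)
      show "(\<Sum>i\<le>n. u1 i / M ^ i) \<le> B1 * (real n + 1) ^ k" by (rule 1(5)) (simp add: M_def)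
      have "(\<Sum>i\<le>n. if t \<le> i then u2 (i - t) / M ^ (i - t) else 0) \<le> (\<Sum>i\<le>n. u2 i / M ^ i)"
        using sum_shift_le[of "\<lambda>i. u2 i / M ^ i" t n] 2(3) M(2) by simp
      also have "\<dots> \<le> B2 * (real n + 1) ^ k" by (rule 2(5)) (simp add: M_def)
      finally show "(\<Sum>i\<le>n. if t \<le> i then u2 (i - t) / M ^ (i - t) else 0) \<le> B2 * (real n + 1) ^ k" .
      show "0 \<le> c / M ^ t" using c M(2) by simp
    qed
    finally show ?thesis by (simp add: algebra_simps)
  qed
  moreover have "0 \<le> B1 + c / M ^ t * B2" using 1(2) 2(2) c M(2) by simp
  moreover have "0 \<le> u n" for n using 1(3) 2(3) c by (simp add: u_def)
  ultimately show ?thesis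
    unfolding cov_growth_def using M(1) cov
    by (intro exI[of _ M] exI[of _ "B1 + c / M ^ t * B2"] exI[of _ u]) blast
qed

text \<open>Submultiplicativity is only available for elements of \<open>R\<close>, not for real vectors, so the
  infimum in the quotient norm is approximated by representatives in \<open>R\<close>.\<close>

lemma rational_approx:
  assumes J: "gideal J" and w: "w \<in> span (iota n ` J n)"
  shows "w \<in> V n \<and> (\<forall>\<delta>>0. \<exists>p\<in>J n. nrm n (w - iota n p) < \<delta>)"
  using w
proof (induction rule: span_induct_alt)
  case base
  have "iota n 0 = 0" using iota_scale[OF zero_in_Rg, of n 0] by simp
  then show ?case
    using subspace_0[OF V_subspace] gideal_zero[OF J, of n] nrm_zero by (intro conjI allI impI bexI[of _ 0]) auto
next
  case (step c v w)
  then obtain x where x: "v = iota n x" "x \<in> J n" by blast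
  have xR: "x \<in> Rg n" by (rule gideal_subset[OF J x(2)])
  have vV: "v \<in> V n" unfolding x by (rule iota_V[OF xR])
  have "c *\<^sub>R v + w \<in> V n"
    using vV step by (intro subspace_add[OF V_subspace] subspace_scale[OF V_subspace]) auto
  moreover have "\<exists>p\<in>J n. nrm n (c *\<^sub>R v + w - iota n p) < \<delta>" if \<delta>: "\<delta> > 0" for \<delta>
  proof -
    obtain p where p: "p \<in> J n" "nrm n (w - iota n p) < \<delta> / 2"
      using step \<delta> by (meson half_gt_zero)
    define N where "N = nrm n v"
    have N: "0 \<le> N" unfolding N_def by (rule nrm_nonneg[OF vV])
    \<comment> \<open>Half of \<delta> pays for rounding the coefficient \<open>c\<close>, the other
      half for \<open>p\<close>. The \<open>+ 1\<close> avoids division by zero when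
      \<open>v\<close> is zero.\<close>
    define h where "h = \<delta> / (2 * (N + 1))"
    have h: "0 < h" unfolding h_def using N \<delta> by simp
    then obtain q where q: "c < real_of_rat q" "real_of_rat q < c + h" using of_rat_dense[of c "c + h"] by auto
    have "\<bar>c - real_of_rat q\<bar> * N \<le> h * N" using q N by (intro mult_right_mono) auto
    also have "\<dots> \<le> h * (N + 1)" using h by simp
    also have "\<dots> = \<delta> / 2" unfolding h_def using N by (simp add: field_simps)
    finally have qN: "\<bar>c - real_of_rat q\<bar> * N \<le> \<delta> / 2" .
    have pR: "p \<in> Rg n" by (rule gideal_subset[OF J p(1)])
    have "iota n (of_rat q * x + p) = real_of_rat q *\<^sub>R v + iota n p"
      using iota_add[OF Rg_scale[OF xR] pR] iota_scale[OF xR] x by simp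
    then have "c *\<^sub>R v + w - iota n (of_rat q * x + p) = (c - real_of_rat q) *\<^sub>R v + (w - iota n p)"
      by (simp add: algebra_simps)
    moreover have "(c - real_of_rat q) *\<^sub>R v \<in> V n"
      by (rule subspace_scale[OF V_subspace vV])
    moreover have "w - iota n p \<in> V n"
      using step iota_V[OF pR] by (intro subspace_diff[OF V_subspace]) auto
    ultimately have "nrm n (c *\<^sub>R v + w - iota n (of_rat q * x + p))
        \<le> nrm n ((c - real_of_rat q) *\<^sub>R v) + nrm n (w - iota n p)"
      using nrm_add by metis
    also have "\<dots> < \<delta>" using qN p(2) nrm_scale[OF vV] by (simp add: N_def)
    finally show ?thesis
      using gideal_add[OF J gideal_scale[OF J x(2)] p(1)] by blast
  qed
  ultimately show ?case by blast
qed

text \<open>Some real \<open>w\<close> brings the norm below \<open>c\<close>, and the remaining gap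
  is spent on replacing \<open>w\<close> by an element of \<open>J m\<close>. This gap needs the
  strict inequality in the hypothesis, which is why a factor \<open>K > 1\<close> is introduced
  later.\<close>

lemma quot_norm_approx:
  assumes J: "gideal J" and s: "s \<in> Rg m"
    and q: "quot_norm (Rg m) (Rtot J) (iota m) (nrm m) s < c"
  shows "\<exists>s'\<in>Rg m. s - s' \<in> J m \<and> anorm m s' < c"
proof -
  let ?X = "{nrm m (iota m s + w) | w. w \<in> span (iota m ` J m)}"
  have "?X \<noteq> {}" using span_zero by blast
  moreover have "Inf ?X < c" using q unfolding quot_norm_def Rtot_inter[OF J] .
  ultimately obtain w where w: "w \<in> span (iota m ` J m)" "nrm m (iota m s + w) < c"
    using cInf_lessD[of ?X c] by blast
  have wV: "w \<in> V m" using rational_approx[OF J w(1)] by blast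
  obtain p where p: "p \<in> J m" "nrm m (w - iota m p) < c - nrm m (iota m s + w)"
    using rational_approx[OF J w(1)] w(2) by (meson diff_gt_0_iff_gt)
  have pR: "p \<in> Rg m" by (rule gideal_subset[OF J p(1)])
  have V: "iota m s + w \<in> V m" "w - iota m p \<in> V m"
    using iota_V[OF s] iota_V[OF pR] wV V_subspace[of m] by (simp_all add: subspace_add subspace_diff)
  have "iota m (s + p) = (iota m s + w) + (-1) *\<^sub>R (w - iota m p)"
    using iota_add[OF s pR] by simp
  then have "anorm m (s + p) \<le> nrm m (iota m s + w) + nrm m ((-1) *\<^sub>R (w - iota m p))"
    unfolding anorm_def using V nrm_add subspace_scale[OF V_subspace] by metis
  also have "\<dots> < c" using nrm_scale[OF V(2), of "-1"] p(2) by simp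
  finally have "anorm m (s + p) < c" .
  moreover have "s - (s + p) \<in> J m" using gideal_scale[OF J p(1), of "-1"] by simp
  ultimately show ?thesis using Rg_add[OF s pR] by blast
qed

text \<open>\<open>Cov_step\<close> with \<open>J\<close> as its own second ideal peels off one
  factor \<open>s\<close> per round. The cost \<open>M ^ m\<close> of a round matches the drop of
  \<open>m\<close> in the weight exponent, and because \<open>m \<ge> 1\<close> the factors
  \<open>K\<close> accumulate to at most \<open>K ^ n\<close>.\<close>

lemma Cov_prime:
  assumes J: "gideal J" and s: "s \<in> Zg m" and m: "m \<ge> 1"
    and s': "s' \<in> Rg m" "s - s' \<in> J m" "anorm m s' \<le> K * M ^ m" and K: "1 \<le> K" and M: "0 < M"
    and u: "\<And>n. 0 \<le> u n" "\<And>n. Cov (gadd J m s) n (u n)"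
  shows "Cov J n (K ^ n * M ^ n * (\<Sum>j\<le>n. u j / M ^ j))"
proof (induction n rule: less_induct)
  case (less n)
  let ?U = "\<lambda>n. \<Sum>j\<le>n. u j / M ^ j"
  have U: "0 \<le> ?U n" for n using u M by (intro sum_nonneg) simp
  show ?case
  proof (cases "m \<le> n")
    case False
    have "u n = M ^ n * (u n / M ^ n)" using M by simp
    also have "\<dots> \<le> M ^ n * ?U n"
      using u M by (intro mult_left_mono member_le_sum) auto
    also have "\<dots> \<le> K ^ n * (M ^ n * ?U n)"
      using K one_le_power[OF K, of n] M U[of n] mult_right_mono[of 1 "K ^ n" "M ^ n * ?U n"] by simp
    finally show ?thesis using Cov_mono[OF Cov_gadd_low[OF _ u(2)]] False by (simp add: mult.assoc)
  next
    case True
    obtain l where l: "n = m + l" using True le_Suc_ex by blast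
    have l': "n - m = l" "l < n" using l m by auto
    have "Cov J n (u n + K * M ^ m * (K ^ l * M ^ l * ?U l))"
      by (rule Cov_step[OF J J s s' _ True u(2)])
        (use less.IH[OF l'(2)] l' gideal_mult[OF J Zg_Rg[OF s]] in auto)
    moreover have "u n + K * M ^ m * (K ^ l * M ^ l * ?U l) \<le> K ^ n * M ^ n * ?U n"
    proof -
      have Kn: "K * K ^ l \<le> K ^ n" unfolding power_Suc[symmetric] using K l' by (intro power_increasing) auto
      have "K * M ^ m * (K ^ l * M ^ l * ?U l) = (K * K ^ l) * (M ^ n * ?U l)"
        by (simp add: l power_add)
      also have "\<dots> \<le> K ^ n * (M ^ n * ?U l)"
        using Kn M U[of l] by (intro mult_right_mono) auto
      finally have A: "K * M ^ m * (K ^ l * M ^ l * ?U l) \<le> K ^ n * (M ^ n * ?U l)" .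
      have "u n = 1 * (M ^ n * (u n / M ^ n))" using M by simp
      also have "\<dots> \<le> K ^ n * (M ^ n * (u n / M ^ n))"
        using one_le_power[OF K, of n] M u(1)[of n] by (intro mult_right_mono) auto
      finally have "u n + K * M ^ m * (K ^ l * M ^ l * ?U l) \<le> K ^ n * (M ^ n * (u n / M ^ n + ?U l))"
        using A by (simp add: algebra_simps)
      \<comment> \<open>Since \<open>l < n\<close>, the top term is not yet in the sum; the degrees
        strictly between may be added because all terms are nonnegative.\<close>
      also have "u n / M ^ n + ?U l = (\<Sum>j\<in>insert n {..l}. u j / M ^ j)" using l'(2) by simp
      also have "\<dots> \<le> ?U n" using u M l'(2) by (intro sum_mono2) auto
      finally show ?thesis using K M by (simp add: mult.assoc)
    qed
    ultimately show ?thesis by (rule Cov_mono)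
  qed
qed

section \<open>Induction on dimension and Noetherian induction\<close>

text \<open>The closed subset defined by \<open>J\<close> has dimension less than \<open>k\<close>:
  chains descend, so a chain lies above \<open>J\<close> as soon as its last and smallest member
  \<open>c j\<close> does. The strict form lets \<open>k = 0\<close> stand for the empty
  subset.\<close>

definition coheight_less :: "(nat \<Rightarrow> 'a set) \<Rightarrow> nat \<Rightarrow> bool" where
  "coheight_less J k \<longleftrightarrow> (\<forall>j c. prime_chain Rg j c \<and> (\<forall>n. J n \<subseteq> c j) \<longrightarrow> j < k)"

lemma coheight_less_mono: "J \<le> K \<Longrightarrow> coheight_less J k \<Longrightarrow> coheight_less K k"
  unfolding coheight_less_def le_fun_def by blast

text \<open>A chain above the sum ideal can be prolonged by \<open>Rtot J\<close>; the new inclusion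
  is strict because \<open>s\<close> lies in every member of the chain but not in
  \<open>Rtot J\<close>.\<close>

lemma coheight_less_gadd:
  assumes P: "gprime J" and sub: "Rtot J \<in> subvarieties Rg" and s: "s \<in> Rg m" "s \<notin> Rtot J"
    and k: "coheight_less J (Suc k)"
  shows "coheight_less (gadd J m s) k"
  unfolding coheight_less_def
proof (intro allI impI, elim conjE)
  fix j c assume c: "prime_chain Rg j c" and sup: "\<forall>n. gadd J m s n \<subseteq> c j"
  have J: "gideal J" using P by (simp add: gprime_def)
  have sJ: "s \<notin> J m" using s(2) Rtot_base[of s J m] by blast
  have JG: "J n \<subseteq> gadd J m s n" for n
    using gadd_greater[OF J s(1) sJ] unfolding less_fun_def le_fun_def by blast
  have sG: "s \<in> gadd J m s m"
    unfolding gadd_def using one_in_Rg gideal_zero[OF J, of m]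
    by (intro CollectI exI[of _ "0::'a"] exI[of _ "1::'a"]) simp
  have "is_ideal (Rtot Rg) (c j)"
    using c subvarieties_prime unfolding prime_chain_def is_prime_ideal_def by blast
  then have sum: "sum x F \<in> c j" if "\<And>i. i \<in> F \<Longrightarrow> x i \<in> c j" for x and F :: "nat set"
    using that by (induction F rule: infinite_finite_induct) (auto simp: is_ideal_def)
  have "Rtot J \<subseteq> c j"
  proof
    fix y assume "y \<in> Rtot J"
    then obtain F x where x: "\<forall>i\<in>F. x i \<in> J i" "y = sum x F"
      unfolding Rtot_def by auto
    have "x i \<in> c j" if "i \<in> F" for i
      using x(1) JG[of i] sup that by blast
    then show "y \<in> c j" unfolding x(2) by (rule sum)
  qed
  moreover have "s \<in> c j" using sG sup by blast
  ultimately have strict: "Rtot J \<subset> c j" using s(2) by blast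
  define c' where "c' i = (if i \<le> j then c i else Rtot J)" for i
  have "prime_chain Rg (Suc j) c'"
    using c sub strict unfolding prime_chain_def c'_def by (auto simp: le_Suc_eq less_Suc_eq)
  moreover have "\<forall>n. J n \<subseteq> c' (Suc j)" using Rtot_base[of _ J] by (auto simp: c'_def)
  ultimately show "j < k" using k unfolding coheight_less_def by blast
qed

text \<open>The bound is pointwise with exponent \<open>k\<close>, although the partial sums behind
  \<open>cov_growth\<close> would need \<open>Suc k\<close>. The hypothesis \<open>IH\<close> makes
  it usable both inside the Noetherian induction, where it is summed, and directly for the zero
  ideal, where not summing saves a factor \<open>n\<close>.\<close>

lemma prime_step:
  assumes P: "gprime J" and rel: "\<not> (\<forall>n\<ge>1. Rg n \<subseteq> J n)" and k: "coheight_less J (Suc k)"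
    and IH: "\<And>K k. gideal K \<Longrightarrow> J < K \<Longrightarrow> coheight_less K k \<Longrightarrow> cov_growth K k"
  shows "\<exists>M B. max_upsilon M \<and> 0 \<le> B \<and> (\<forall>n. Cov J n (M ^ n * (B * (real n + 1) ^ k)))"
proof -
  have J: "gideal J" using P by (simp add: gprime_def)
  have sub: "Rtot J \<in> subvarieties Rg" by (rule Rtot_in_subvarieties[OF P rel])
  define v where "v = upsilon (Rtot J)"
  obtain m s where m: "m \<ge> 1" and s: "s \<in> Zg m" "s \<notin> Rtot J"
    and q: "quot_norm (Rg m) (Rtot J) (iota m) (nrm m) s \<le> v ^ m"
    using ups sub unfolding v_def by blast
  have sR: "s \<in> Rg m" by (rule Zg_Rg[OF s(1)])
  have sJ: "s \<notin> J m" using s(2) Rtot_base[of s J m] by blast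
  have "cov_growth (gadd J m s) k"
    by (intro IH gideal_gadd[OF J sR] gadd_greater[OF J sR sJ] coheight_less_gadd[OF P sub sR s(2) k])
  then obtain M0 B u where b: "max_upsilon M0" "0 \<le> B" "\<And>n. 0 \<le> u n" "\<And>n. Cov (gadd J m s) n (u n)"
    "\<And>n M'. M0 \<le> M' \<Longrightarrow> (\<Sum>i\<le>n. u i / M' ^ i) \<le> B * (real n + 1) ^ k"
    by (rule cov_growthE) blast
  define M where "M = max M0 v"
  have M: "max_upsilon M" unfolding M_def v_def by (intro max_upsilon_max b max_upsilon_single sub)
  have M0: "0 < M" by (rule max_upsilon_pos[OF M])
  have v: "0 < v" using ups_pos sub by (simp add: v_def)
  have "Cov J n (M ^ n * (2 * B * (real n + 1) ^ k))" for n
  proof -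
    \<comment> \<open>\<open>K\<close>, and with it the representative \<open>s'\<close>, depends on
      \<open>n\<close>: this keeps \<open>K ^ n\<close> below 2. The index \<open>Suc n\<close> also
      covers \<open>n = 0\<close>, where a root of order \<open>n\<close> would be
      degenerate.\<close>
    define K where "K = root (Suc n) 2"
    have K: "1 < K" unfolding K_def by simp
    have "K ^ n \<le> K ^ Suc n" using K by (intro power_increasing) auto
    then have Kn: "K ^ n \<le> 2" unfolding K_def by (simp add: real_root_pow_pos2 del: power_Suc)
    have "v ^ m \<le> M ^ m" using v by (intro power_mono) (auto simp: M_def)
    also have "\<dots> < K * M ^ m" using K M0 by simp
    finally have "quot_norm (Rg m) (Rtot J) (iota m) (nrm m) s < K * M ^ m" using q by simp
    then obtain s' where s': "s' \<in> Rg m" "s - s' \<in> J m" "anorm m s' < K * M ^ m"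
      using quot_norm_approx[OF J sR] by blast
    have "Cov J n (K ^ n * M ^ n * (\<Sum>j\<le>n. u j / M ^ j))"
      by (rule Cov_prime[OF J s(1) m s'(1,2) less_imp_le[OF s'(3)] less_imp_le[OF K] M0 b(3,4)])
    moreover have "K ^ n * M ^ n * (\<Sum>j\<le>n. u j / M ^ j) \<le> 2 * M ^ n * (B * (real n + 1) ^ k)"
      using Kn M0 b(2,3) K by (intro mult_mono b(5)) (auto simp: M_def intro!: sum_nonneg)
    ultimately show ?thesis by (elim Cov_mono) (simp add: mult_ac)
  qed
  then show ?thesis using M b(2) by (intro exI[of _ M] exI[of _ "2 * B"]) simp
qed

text \<open>The assumption \<open>ne\<close> provides a value of \<open>upsilon\<close> for
  irrelevant ideals: no subvariety lies above them, yet \<open>cov_growth\<close> asks for a maximum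
  over a nonempty set.\<close>

lemma cov_growth_of_coheight:
  assumes ne: "subvarieties Rg \<noteq> {}" and J: "gideal J" and k: "coheight_less J k"
  shows "cov_growth J k"
proof -
  obtain Y0 where Y0: "Y0 \<in> subvarieties Rg" using ne by blast
  define M0 where "M0 = upsilon Y0"
  have M0: "max_upsilon M0" "M0 > 0" unfolding M0_def using max_upsilon_single[OF Y0] max_upsilon_pos by blast+
  have "\<forall>k. coheight_less J k \<longrightarrow> cov_growth J k"
    using J
  proof (induction rule: gideal_induct)
    case (step J)
    note J = step(1)
    have IH: "cov_growth K k" if "gideal K" "J < K" "coheight_less K k" for K k
      using step(2) that by blast
    \<comment> \<open>Only degree 0 has a nonzero radius, so the partial sums are bounded and every
      exponent is allowed, including 0.\<close>
    have irr: "cov_growth J k" if triv: "\<forall>n\<ge>1. Rg n \<subseteq> J n" for k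
    proof -
      obtain r where r: "r \<ge> 0" "Cov J 0 r" using Cov_exists[OF J] by blast
      define u where "u n = (if n = 0 then r else 0)" for n :: nat
      have "0 \<le> u n \<and> Cov J n (u n)" for n
        using r triv Cov_trivial[of n J] by (auto simp: u_def)
      moreover have "(\<Sum>i\<le>n. u i / M0 ^ i) \<le> r * (real n + 1) ^ k" for n
      proof -
        have "(\<Sum>i\<le>n. u i / M0 ^ i) = (\<Sum>i\<le>n. if i = 0 then r else 0)"
          by (intro sum.cong) (auto simp: u_def)
        also have "\<dots> = r" by simp
        also have "\<dots> \<le> r * (real n + 1) ^ k"
          using r(1) one_le_power[of "real n + 1" k] mult_left_mono[of 1 "(real n + 1) ^ k" r] by simp
        finally show ?thesis .
      qed
      ultimately show ?thesis unfolding cov_growth_def using M0(1) r(1) by blast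
    qed
    show ?case
    proof (intro allI impI)
      fix k assume k: "coheight_less J k"
      consider "1 \<in> J 0" | "\<forall>n\<ge>1. Rg n \<subseteq> J n"
        | "gprime J" "\<not> (\<forall>n\<ge>1. Rg n \<subseteq> J n)" | "1 \<notin> J 0" "\<not> gprime J" by blast
      then show "cov_growth J k"
      proof cases
        case 1
        have "x \<in> J n" if "x \<in> Rg n" for x n
          using gideal_mult[OF J that 1] by simp
        then show ?thesis using irr by blast
      next
        case 2
        then show ?thesis by (rule irr)
      next
        case 3
        \<comment> \<open>The chain consisting of the prime alone rules out
          \<open>k = 0\<close>.\<close>
        have "prime_chain Rg 0 (\<lambda>_. Rtot J)"
          unfolding prime_chain_def using Rtot_in_subvarieties[OF 3] by simp
        then have "0 < k" using k Rtot_base[of _ J] unfolding coheight_less_def by blast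
        then obtain l where l: "k = Suc l" using gr0_implies_Suc by blast
        obtain M B where MB: "max_upsilon M" "0 \<le> B" "\<And>n. Cov J n (M ^ n * (B * (real n + 1) ^ l))"
          using prime_step[OF 3 k[unfolded l] IH] by blast
        have M: "0 < M" by (rule max_upsilon_pos[OF MB(1)])
        \<comment> \<open>Each of the \<open>n + 1\<close> terms is bounded by the last one; this is
          where a dimension costs one factor \<open>n\<close>.\<close>
        have "(\<Sum>i\<le>n. M ^ i * (B * (real i + 1) ^ l) / M ^ i) \<le> B * (real n + 1) ^ k" for n
        proof -
          have "(\<Sum>i\<le>n. M ^ i * (B * (real i + 1) ^ l) / M ^ i) \<le> (\<Sum>i\<le>n. B * (real n + 1) ^ l)"
            using M MB(2) by (intro sum_mono) (auto intro!: mult_left_mono power_mono)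
          then show ?thesis by (simp add: l algebra_simps)
        qed
        then show ?thesis
          unfolding cov_growth_def using MB M
          by (intro exI[of _ M] exI[of _ B] exI[of _ "\<lambda>n. M ^ n * (B * (real n + 1) ^ l)"]) auto
      next
        case 4
        then obtain t r a0 b where a0: "a0 \<in> Rg t" "a0 \<notin> J t" and b: "b \<in> Rg r" "b \<notin> J r"
          and ab0: "a0 * b \<in> J (t + r)"
          using J unfolding gprime_def by blast
        \<comment> \<open>The filtration needs an integral element. A nonzero integer multiple of
          \<open>a0\<close> stays outside \<open>J\<close>, and its product with \<open>b\<close>
          stays inside, because the pieces of \<open>J\<close> are rational subspaces.\<close>
        obtain D :: int where D: "D > 0" "of_int D * a0 \<in> Zg t" using clear_denominator[OF a0(1)] by blast
        define a where "a = of_int D * a0"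
        have aZ: "a \<in> Zg t" using D by (simp add: a_def)
        have aR: "a \<in> Rg t" by (rule Zg_Rg[OF aZ])
        have "of_rat (inverse (of_int D)) * a = a0"
          using D(1) by (simp add: a_def of_rat_inverse)
        then have aJ: "a \<notin> J t" using a0(2) gideal_scale[OF J] by metis
        have "a * b = of_rat (of_int D) * (a0 * b)" by (simp add: a_def)
        then have ab: "a * b \<in> J (t + r)" using gideal_scale[OF J ab0] by metis
        have g1: "J < gadd J t a" by (rule gadd_greater[OF J aR aJ])
        have g2: "J < gcolon J t a" by (rule gcolon_greater[OF J aR b ab])
        show ?thesis
          using g1 g2 k coheight_less_mono
          by (intro cov_growth_filtration[OF J aZ] IH gideal_gadd gideal_gcolon J aR) (auto dest: less_imp_le)
      qed
    qed
  qed
  then show ?thesis using k by blast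
qed

text \<open>Approximating the points of a fine subdivision of the segment from \<open>0\<close> to a lattice vector
  writes that vector as a sum of lattice vectors of norm at most about \<open>2 * r\<close>.\<close>

lemma lambdaQ_le_Cov:
  assumes cov: "Cov (\<lambda>_. {0}) n r" and r: "0 \<le> r"
  shows "lambdaQ (Zg n) (anorm n) \<le> 2 * r"
proof (rule field_le_epsilon)
  fix \<delta> :: real assume \<delta>: "0 < \<delta>"
  define E where "E = {z \<in> Zg n. anorm n z \<le> 2 * r + \<delta>}"
  have "x \<in> Qvec.span E" if x: "x \<in> Zg n" for x
  proof -
    have xR: "x \<in> Rg n" by (rule Zg_Rg[OF x])
    obtain N :: nat where N: "anorm n x / \<delta> < real N" using reals_Archimedean2 by blast
    have N0: "N > 0"
      using N anorm_nonneg[OF xR] \<delta> by (metis divide_nonneg_pos gr0I not_less of_nat_0)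
    have xN: "anorm n x / real N \<le> \<delta>" using N N0 \<delta> by (simp add: field_simps)
    define y where "y k = of_rat (of_nat k / of_nat N) * x" for k :: nat
    have yR: "y k \<in> Rg n" for k unfolding y_def by (rule Rg_scale[OF xR])
    \<comment> \<open>The two endpoints are lattice vectors and are kept exactly, so that the
      differences of consecutive \<open>z k\<close> telescope to \<open>x\<close>.\<close>
    have "\<exists>z. z \<in> Zg n \<and> anorm n (y k - z) \<le> r \<and> (k = 0 \<longrightarrow> z = 0) \<and> (k = N \<longrightarrow> z = x)" for k
    proof -
      consider "k = 0" | "k = N" | "k \<noteq> 0" "k \<noteq> N" by blast
      then show ?thesis
      proof cases
        case 1
        then show ?thesis using Zg_zero N0 r anorm_zero by (intro exI[of _ 0]) (simp add: y_def)
      next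
        case 2
        then show ?thesis using x N0 r anorm_zero by (intro exI[of _ x]) (simp add: y_def)
      next
        case 3
        then show ?thesis using CovD[OF cov yR[of k]] by (metis diff_zero singletonD)
      qed
    qed
    then obtain z where z: "\<And>k. z k \<in> Zg n" "\<And>k. anorm n (y k - z k) \<le> r" "z 0 = 0" "z N = x" by metis
    have zR: "z k \<in> Rg n" for k by (rule Zg_Rg[OF z(1)])
    have "z (Suc k) - z k \<in> E" for k
    proof -
      have "y (Suc k) = y k + of_rat (1 / of_nat N) * x"
        by (simp add: y_def add_divide_distrib of_rat_add distrib_right)
      then have eq: "z (Suc k) - z k
          = - (y (Suc k) - z (Suc k)) + (of_rat (1 / of_nat N) * x + (y k - z k))"
        by simp
      have "anorm n (z (Suc k) - z k) \<le> anorm n (- (y (Suc k) - z (Suc k))) + anorm n (of_rat (1 / of_nat N) * x + (y k - z k))"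
        unfolding eq
        using Rg_diff[OF zero_in_Rg Rg_diff[OF yR[of "Suc k"] zR[of "Suc k"]]]
        by (intro anorm_add Rg_add Rg_scale Rg_diff xR yR zR) simp
      also have "\<dots> \<le> anorm n (y (Suc k) - z (Suc k)) + (anorm n (of_rat (1 / of_nat N) * x) + anorm n (y k - z k))"
        using anorm_minus[OF Rg_diff[OF yR zR]] anorm_add[OF Rg_scale[OF xR] Rg_diff[OF yR zR]] by (intro add_mono) auto
      also have "\<dots> \<le> r + (\<delta> + r)"
        using anorm_scale[OF xR, of "1 / of_nat N"] xN z(2) by (intro add_mono) (auto simp: of_rat_divide)
      finally show ?thesis unfolding E_def using Zg_diff[OF z(1) z(1)] by simp
    qed
    then have "z k \<in> Qvec.span E" for k
    proof (induction k)
      case 0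
      then show ?case using z(3) Qvec.span_zero by simp
    next
      case (Suc k)
      have "z k + (z (Suc k) - z k) \<in> Qvec.span E"
        by (rule Qvec.span_add[OF Suc.IH[OF Suc.prems] Qvec.span_base[OF Suc.prems]])
      then show ?case by simp
    qed
    then show ?thesis using z(4) by metis
  qed
  then have span: "Zg n \<subseteq> Qvec.span E" by blast
  obtain B where B: "B \<subseteq> E" "Qvec.independent B" "E \<subseteq> Qvec.span B"
    by (rule Qvec.maximal_independent_subset)
  have "Qvec.span B = Qvec.span (Zg n)"
  proof
    show "Qvec.span B \<subseteq> Qvec.span (Zg n)" using B(1) by (intro Qvec.span_mono) (auto simp: E_def)
    have "Qvec.span E \<subseteq> Qvec.span B" by (rule Qvec.span_minimal[OF B(3) Qvec.subspace_span])
    then show "Qvec.span (Zg n) \<subseteq> Qvec.span B"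
      using span by (intro Qvec.span_minimal[OF _ Qvec.subspace_span]) blast
  qed
  then have mem: "2 * r + \<delta> \<in> {l. l \<ge> 0 \<and> (\<exists>E. E \<subseteq> Zg n \<and> qindep E \<and> qspan E = qspan (Zg n) \<and> (\<forall>e\<in>E. anorm n e \<le> l))}"
    unfolding qspan_eq_span qindep_iff_independent using B r \<delta> by (auto simp: E_def intro!: exI[of _ B])
  have "Inf {l. l \<ge> 0 \<and> (\<exists>E. E \<subseteq> Zg n \<and> qindep E \<and> qspan E = qspan (Zg n) \<and> (\<forall>e\<in>E. anorm n e \<le> l))} \<le> 2 * r + \<delta>"
    by (rule cInf_lower[OF mem]) (auto intro: bdd_belowI[of _ 0])
  then show "lambdaQ (Zg n) (anorm n) \<le> 2 * r + \<delta>"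
    unfolding lambdaQ_def using r \<delta> by simp
qed

section \<open>The bound for the zero ideal\<close>

lemma gprime_zero: "gprime (\<lambda>_. {0})"
  unfolding gprime_def gideal_def by simp

lemma lambdaQ_bound:
  "\<exists>B>0. \<exists>S. finite S \<and> S \<subseteq> subvarieties Rg \<and>
     (\<forall>n\<ge>1. lambdaQ (Zg n) (anorm n)
        \<le> B * real n ^ (dimProj Rg * (dimProj Rg + 1) div 2) * Max (insert 0 (upsilon ` S)) ^ n)"
proof (cases "subvarieties Rg = {}")
  case True
  \<comment> \<open>If some positive degree were nonzero, the zero ideal would be a relevant prime.
    All these lattices therefore vanish and \<open>lambdaQ\<close> takes its torsion value
    0.\<close>
  have zero: "Zg n \<subseteq> {0}" if "n \<ge> 1" for n
    using Rtot_in_subvarieties[OF gprime_zero] True that Zg_Rg by blast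
  have "lambdaQ (Zg n) (anorm n) = 0" if "n \<ge> 1" for n
  proof -
    have "\<forall>x\<in>Zg n. \<exists>k::int. k \<noteq> 0 \<and> of_int k * x = 0"
      using zero[OF that] by (intro ballI exI[of _ 1]) auto
    then show ?thesis unfolding lambdaQ_def by (rule if_P)
  qed
  then show ?thesis by (intro exI[of _ 1] conjI exI[of _ "{}"]) auto
next
  case False
  define d where "d = dimProj Rg"
  obtain Y where Y: "Y \<in> subvarieties Rg" using False by blast
  then have "0 \<in> Y" "\<not> (\<forall>n\<ge>1. Rg n \<subseteq> Y)"
    unfolding subvarieties_def relevant_hom_prime_def by simp_all
  then have rel: "\<not> (\<forall>n\<ge>1. Rg n \<subseteq> {0})" by blast
  have co: "coheight_less (\<lambda>_. {0}) (Suc d)"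
    unfolding coheight_less_def d_def using prime_chain_le_dimProj le_imp_less_Suc by blast
  have IH: "cov_growth K k" if "gideal K" "(\<lambda>_. {0}) < K" "coheight_less K k" for K k
    by (rule cov_growth_of_coheight[OF False that(1,3)])
  obtain M B where MB: "max_upsilon M" "0 \<le> B" "\<And>n. Cov (\<lambda>_. {0}) n (M ^ n * (B * (real n + 1) ^ d))"
    using prime_step[OF gprime_zero rel co IH] by blast
  have M: "0 < M" by (rule max_upsilon_pos[OF MB(1)])
  obtain S where S: "finite S" "S \<noteq> {}" "S \<subseteq> subvarieties Rg" "M = Max (upsilon ` S)"
    using MB(1) unfolding max_upsilon_def by blast
  have Max: "Max (insert 0 (upsilon ` S)) = M" using S M by simp
  \<comment> \<open>The factor 2 is the passage from covering radius to \<open>lambdaQ\<close>,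
    \<open>2 ^ d\<close> absorbs \<open>n + 1 \<le> 2 * n\<close>, and \<open>+ 1\<close> keeps
    \<open>C\<close> positive when \<open>B = 0\<close>.\<close>
  define C where "C = 2 * B * 2 ^ d + 1"
  have dd: "d \<le> d * (d + 1) div 2"
  proof (cases d)
    case (Suc e)
    have "2 * d \<le> d * (d + 1)" unfolding Suc by simp
    then show ?thesis by linarith
  qed simp
  have "lambdaQ (Zg n) (anorm n) \<le> C * real n ^ (d * (d + 1) div 2) * M ^ n" if n: "n \<ge> 1" for n
  proof -
    have "lambdaQ (Zg n) (anorm n) \<le> 2 * (M ^ n * (B * (real n + 1) ^ d))"
      using M MB(2) by (intro lambdaQ_le_Cov MB(3)) simp
    also have "\<dots> \<le> 2 * (M ^ n * (B * (2 * real n) ^ d))"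
      using M MB(2) n by (intro mult_left_mono power_mono) auto
    also have "\<dots> = (2 * B * 2 ^ d) * real n ^ d * M ^ n" by (simp add: power_mult_distrib mult_ac)
    also have "\<dots> \<le> C * real n ^ (d * (d + 1) div 2) * M ^ n"
      using M MB(2) n dd by (intro mult_right_mono mult_mono power_increasing) (auto simp: C_def)
    finally show ?thesis .
  qed
  moreover have "C > 0" using MB(2) by (simp add: C_def add_nonneg_pos)
  ultimately show ?thesis
    using S(1,3) unfolding d_def[symmetric] by (intro exI[of _ C] conjI exI[of _ S]) (auto simp: Max)
qed

end

theorem theorem5p4:
  fixes Rg Zg :: "nat \<Rightarrow> 'a::field_char_0 set"
    and V :: "nat \<Rightarrow> 'v::real_vector set"
    and iota :: "nat \<Rightarrow> 'a \<Rightarrow> 'v"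
    and nrm :: "nat \<Rightarrow> 'v \<Rightarrow> real"
    and upsilon :: "'a set \<Rightarrow> real"
  assumes R: "graded_Qalg_fin_type Rg"
    and Z: "integral_structure Rg Zg"
    and bc: "\<forall>n. real_base_change (Rg n) (V n) (iota n)"
    and nm: "\<forall>n. is_norm_on (V n) (nrm n)"
    and submult: "\<forall>n n'. \<forall>a\<in>Zg n. \<forall>b\<in>Zg n'.
        nrm (n + n') (iota (n + n') (a * b)) \<le> nrm n (iota n a) * nrm n' (iota n' b)"
    and ups_pos: "\<forall>Y\<in>subvarieties Rg. upsilon Y > 0"
    and ups: "\<forall>Y\<in>subvarieties Rg. \<exists>n\<ge>1. \<exists>s\<in>Zg n. s \<notin> Y \<and>
        quot_norm (Rg n) Y (iota n) (nrm n) s \<le> upsilon Y ^ n"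
  shows "\<exists>B>0. \<exists>S. finite S \<and> S \<subseteq> subvarieties Rg \<and>
     (\<forall>n\<ge>1. lambdaQ (Zg n) (\<lambda>e. nrm n (iota n e))
        \<le> B * real n ^ (dimProj Rg * (dimProj Rg + 1) div 2) * Max (insert 0 (upsilon ` S)) ^ n)"
proof -
  interpret normed_graded Rg Zg V iota nrm upsilon
    using assms by unfold_locales
  show ?thesis using lambdaQ_bound unfolding anorm_def .
qed

end
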